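(* Let $G$ be a finitely-generated, just infinite, residually finite group, which is not a linear group. Fix a finite, symmetric generating set $X$ for $G$, and set $\omega(t)=2^{|t|_X}$ $(t\in G)$. Then $\ell^1(G,\omega)$ has the following properties: (i) the intersection of the finite-codimension, maximal left ideals of $\ell^1(G,\omega)$ is $\{0\}$; (ii) every finite-codimension left ideal of $\ell^1(G,\omega)$ is finitely generated.
   Context: Groups are discrete. An infinite group is just infinite if all of its non-trivial quotients (quotients by non-trivial normal subgroups) are finite. A group is linear if it is isomorphic to a subgroup of $GL_n(\mathbb{K})$, the group of invertible $n\times n$ matrices over $\mathbb{K}$, for some $n\in\mathbb{N}$ and some field $\mathbb{K}$. A generating set $X$ is symmetric if $x^{-1}\in X$ for all $x\in X$; $|t|_X$ denotes the word length of $t$ with respect to $X$ (so $|e|_X=0$). A weight on a group $G$ is a function $\omega\colon G\to[1,\infty)$ with $\omega(st)\le\omega(s)\omega(t)$ for all $s,t\in G$ and $\omega(e)=1$; $t\mapsto 2^{|t|_X}$ is a weight. The Beurling algebra is $\ell^1(G,\omega)=\{f\colon G\to\mathbb{C} : \sum_{t\in G}|f(t)|\omega(t)<\infty\}$, a unital Banach algebra under convolution with norm $\|f\|_\omega=\sum_{t\in G}|f(t)|\omega(t)$. A left ideal $I$ of a unital Banach algebra $A$ is finitely generated if there are $n\in\mathbb{N}$ and $a_1,\dots,a_n\in I$ with $I=Aa_1+\cdots+Aa_n$ (algebraically; no closure is taken). In (ii) the left ideals are not assumed to be closed. *)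

theory Defs
  imports "HOL-Algebra.Algebra" "HOL-Analysis.Infinite_Sum"
begin

definition mat_monoid :: "nat \<Rightarrow> ('k, 'm) ring_scheme \<Rightarrow> (nat \<times> nat \<Rightarrow> 'k) monoid" where
  "mat_monoid n K =
    \<lparr>carrier = {..<n} \<times> {..<n} \<rightarrow>\<^sub>E carrier K,
     monoid.mult = (\<lambda>A B. \<lambda>(i, j) \<in> {..<n} \<times> {..<n}. \<Oplus>\<^bsub>K\<^esub>k\<in>{..<n}. A (i, k) \<otimes>\<^bsub>K\<^esub> B (k, j)),
     one = (\<lambda>(i, j) \<in> {..<n} \<times> {..<n}. if i = j then \<one>\<^bsub>K\<^esub> else \<zero>\<^bsub>K\<^esub>)\<rparr>"

definition GL :: "nat \<Rightarrow> ('k, 'm) ring_scheme \<Rightarrow> (nat \<times> nat \<Rightarrow> 'k) monoid" where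
  "GL n K = units_of (mat_monoid n K)"

definition linear_over :: "'k itself \<Rightarrow> ('a, 'b) monoid_scheme \<Rightarrow> bool" where
  "linear_over (_ :: 'k itself) G \<longleftrightarrow>
    (\<exists>n (K :: 'k ring) H. field K \<and> subgroup H (GL n K) \<and> G \<cong> (GL n K)\<lparr>carrier := H\<rparr>)"

text \<open>
  HOL cannot quantify over the types that carry the field inside a formula. For a countable group
  nothing is lost by only using fields whose carrier is a set of natural numbers: the entries of
  the matrices representing the group generate a countable field.
  See \<open>linear_over_imp_linear_group\<close> below, where the field may live in any type; it applies to
  every finitely generated group by \<open>countable_carrier_if_generate\<close>.
\<close>
definition linear_group :: "('a, 'b) monoid_scheme \<Rightarrow> bool" where
  "linear_group G \<longleftrightarrow> linear_over TYPE(nat) G"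

definition just_infinite :: "('a, 'b) monoid_scheme \<Rightarrow> bool" where
  "just_infinite G \<longleftrightarrow> infinite (carrier G) \<and>
    (\<forall>N. N \<lhd> G \<and> N \<noteq> {\<one>\<^bsub>G\<^esub>} \<longrightarrow> finite (carrier (G Mod N)))"

definition residually_finite :: "('a, 'b) monoid_scheme \<Rightarrow> bool" where
  "residually_finite G \<longleftrightarrow>
    (\<forall>g \<in> carrier G. g \<noteq> \<one>\<^bsub>G\<^esub> \<longrightarrow> (\<exists>N. N \<lhd> G \<and> finite (carrier (G Mod N)) \<and> g \<notin> N))"

definition finite_symmetric_generating_set :: "('a, 'b) monoid_scheme \<Rightarrow> 'a set \<Rightarrow> bool" where
  "finite_symmetric_generating_set G S \<longleftrightarrow>
    finite S \<and> S \<subseteq> carrier G \<and> (\<forall>x \<in> S. inv\<^bsub>G\<^esub> x \<in> S) \<and> generate G S = carrier G"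

definition word_length :: "('a, 'b) monoid_scheme \<Rightarrow> 'a set \<Rightarrow> 'a \<Rightarrow> nat" where
  "word_length G S t =
    (LEAST n. \<exists>w. length w = n \<and> set w \<subseteq> S \<and> foldr (monoid.mult G) w \<one>\<^bsub>G\<^esub> = t)"

definition group_weight :: "('a, 'b) monoid_scheme \<Rightarrow> ('a \<Rightarrow> real) \<Rightarrow> bool" where
  "group_weight G \<omega> \<longleftrightarrow> (\<forall>t \<in> carrier G. 1 \<le> \<omega> t) \<and> \<omega> \<one>\<^bsub>G\<^esub> = 1 \<and>
    (\<forall>s \<in> carrier G. \<forall>t \<in> carrier G. \<omega> (s \<otimes>\<^bsub>G\<^esub> t) \<le> \<omega> s * \<omega> t)"

text \<open>
  Functions on the group are represented by functions on the whole type that vanish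
  off the carrier.
\<close>
definition beurling :: "('a, 'b) monoid_scheme \<Rightarrow> ('a \<Rightarrow> real) \<Rightarrow> (complex, 'a \<Rightarrow> complex) module" where
  "beurling G \<omega> =
    \<lparr>carrier = {f. (\<forall>t. t \<notin> carrier G \<longrightarrow> f t = 0) \<and>
                   (\<lambda>t. norm (f t) * \<omega> t) summable_on carrier G},
     monoid.mult = (\<lambda>f g t. if t \<in> carrier G
                     then \<Sum>\<^sub>\<infinity>s\<in>carrier G. f s * g (inv\<^bsub>G\<^esub> s \<otimes>\<^bsub>G\<^esub> t) else 0),
     one = (\<lambda>t. if t = \<one>\<^bsub>G\<^esub> then 1 else 0),
     ring.zero = (\<lambda>t. 0),
     ring.add = (\<lambda>f g t. f t + g t),
     smult = (\<lambda>c f t. c * f t)\<rparr>"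

text \<open>
  The algebra is a module record whose scalars form the type of complex numbers.
  Left ideals are linear subspaces, as usual for algebras; closure under scalars is automatic
  when the algebra is unital.
\<close>
definition left_ideal :: "(complex, 'v, 'm) module_scheme \<Rightarrow> 'v set \<Rightarrow> bool" where
  "left_ideal A I \<longleftrightarrow> additive_subgroup I A \<and>
    (\<forall>c. \<forall>x \<in> I. c \<odot>\<^bsub>A\<^esub> x \<in> I) \<and> (\<forall>a \<in> carrier A. \<forall>x \<in> I. a \<otimes>\<^bsub>A\<^esub> x \<in> I)"

definition maximal_left_ideal :: "(complex, 'v, 'm) module_scheme \<Rightarrow> 'v set \<Rightarrow> bool" where
  "maximal_left_ideal A I \<longleftrightarrow> left_ideal A I \<and> I \<noteq> carrier A \<and>
    (\<forall>J. left_ideal A J \<and> I \<subseteq> J \<longrightarrow> J = I \<or> J = carrier A)"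

text \<open>The quotient space by \<open>I\<close> is spanned by the cosets of finitely many elements.\<close>
definition finite_codim :: "(complex, 'v, 'm) module_scheme \<Rightarrow> 'v set \<Rightarrow> bool" where
  "finite_codim A I \<longleftrightarrow> (\<exists>B. finite B \<and> B \<subseteq> carrier A \<and>
    (\<forall>x \<in> carrier A. \<exists>c. \<exists>y \<in> I. x = y \<oplus>\<^bsub>A\<^esub> (\<Oplus>\<^bsub>A\<^esub>b\<in>B. c b \<odot>\<^bsub>A\<^esub> b)))"

definition finitely_generated_left_ideal :: "(complex, 'v, 'm) module_scheme \<Rightarrow> 'v set \<Rightarrow> bool" where
  "finitely_generated_left_ideal A I \<longleftrightarrow> left_ideal A I \<and>
    (\<exists>(n::nat) a. (\<forall>i<n. a i \<in> I) \<and>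
      I = {\<Oplus>\<^bsub>A\<^esub>i\<in>{..<n}. b i \<otimes>\<^bsub>A\<^esub> a i | b. b \<in> {..<n} \<rightarrow> carrier A})"

lemma (in group) countable_carrier_if_generate:
  assumes "countable S" "generate G S = carrier G"
  shows "countable (carrier G)"
proof -
  define W where "W = (\<lambda>w. foldr (monoid.mult G) w \<one>) ` lists (S \<union> m_inv G ` S)"
  have XG: "S \<subseteq> carrier G" using assms(2) generate.incl[of _ S G] by blast
  have cl: "foldr (monoid.mult G) v \<one> \<in> carrier G" if "set v \<subseteq> S \<union> m_inv G ` S" for v
    using that XG by (induction v) (auto simp: image_subset_iff)
  have app: "foldr (monoid.mult G) (u @ v) \<one> = foldr (monoid.mult G) u \<one> \<otimes> foldr (monoid.mult G) v \<one>"
    if "set u \<subseteq> S \<union> m_inv G ` S" "set v \<subseteq> S \<union> m_inv G ` S" for u v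
    using that(1)
  proof (induction u)
    case Nil then show ?case using cl[OF that(2)] by simp
  next
    case (Cons a u)
    have "a \<in> carrier G" using Cons.prems XG by auto
    then show ?case using Cons cl[of u] cl[OF that(2)] by (simp add: m_assoc)
  qed
  have "t \<in> W" if "t \<in> generate G S" for t
    using that
  proof induction
    case one
    have "foldr (monoid.mult G) [] \<one> = \<one>" by simp
    then show ?case unfolding W_def by (metis imageI lists.Nil)
  next
    case (incl h)
    have "foldr (monoid.mult G) [h] \<one> = h" using incl XG by auto
    then show ?case unfolding W_def using incl by (metis UnI1 imageI lists.Cons lists.Nil)
  next
    case (inv h)
    have "foldr (monoid.mult G) [inv h] \<one> = inv h" using inv XG by auto
    then show ?case unfolding W_def using inv by (metis UnI2 imageI lists.Cons lists.Nil)
  next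
    case (eng h1 h2)
    then obtain u v where uv: "u \<in> lists (S \<union> m_inv G ` S)" "v \<in> lists (S \<union> m_inv G ` S)"
      "h1 = foldr (monoid.mult G) u \<one>" "h2 = foldr (monoid.mult G) v \<one>" unfolding W_def by blast
    have "h1 \<otimes> h2 = foldr (monoid.mult G) (u @ v) \<one>" using app[of u v] uv(3,4) uv(1,2)[unfolded lists_eq_set] by (simp only: mem_Collect_eq)
    moreover have "u @ v \<in> lists (S \<union> m_inv G ` S)" using uv by simp
    ultimately show ?case unfolding W_def by blast
  qed
  then have "carrier G \<subseteq> W" using assms(2) by blast
  moreover have "countable W" unfolding W_def using assms(1) by simp
  ultimately show ?thesis by (rule countable_subset)
qed

context
  fixes G (structure) and S
  assumes G: "group G" and S: "finite_symmetric_generating_set G S"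
begin

interpretation group G by (rule G)

private lemma S_facts:
  shows "S \<subseteq> carrier G" "x \<in> S \<Longrightarrow> inv x \<in> S" "generate G S = carrier G"
  using S unfolding finite_symmetric_generating_set_def by auto

private lemma word_closed: "set w \<subseteq> S \<Longrightarrow> foldr (monoid.mult G) w \<one> \<in> carrier G"
  using S_facts(1) by (induction w) auto

private lemma word_append:
  assumes "set u \<subseteq> S" "set v \<subseteq> S"
  shows "foldr (monoid.mult G) (u @ v) \<one> = foldr (monoid.mult G) u \<one> \<otimes> foldr (monoid.mult G) v \<one>"
  using assms(1)
proof (induction u)
  case Nil then show ?case using word_closed[OF assms(2)] by simp
next
  case (Cons a u)
  have "a \<in> carrier G" using Cons.prems S_facts(1) by auto
  then show ?case using Cons word_closed[of u] word_closed[OF assms(2)] by (simp add: m_assoc)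
qed

lemma word_exists:
  assumes "t \<in> carrier G"
  shows "\<exists>w. set w \<subseteq> S \<and> foldr (monoid.mult G) w \<one> = t"
proof -
  have "t \<in> generate G S" using assms S_facts(3) by simp
  then show ?thesis
  proof induction
    case one then show ?case by (intro exI[of _ "[]"]) simp
  next
    case (incl h) then show ?case using S_facts(1) by (intro exI[of _ "[h]"]) auto
  next
    case (inv h) then show ?case using S_facts(1,2) by (intro exI[of _ "[inv h]"]) auto
  next
    case (eng h1 h2)
    then obtain u v where "set u \<subseteq> S" "foldr (monoid.mult G) u \<one> = h1" "set v \<subseteq> S" "foldr (monoid.mult G) v \<one> = h2"
      by blast
    then show ?case using word_append by (intro exI[of _ "u @ v"]) auto
  qed
qed

lemma word_length_witness:
  assumes "t \<in> carrier G"
  shows "\<exists>w. length w = word_length G S t \<and> set w \<subseteq> S \<and> foldr (monoid.mult G) w \<one> = t"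
  unfolding word_length_def by (rule LeastI_ex) (use word_exists[OF assms] in blast)

lemma word_length_le:
  assumes "set w \<subseteq> S" "foldr (monoid.mult G) w \<one> = t"
  shows "word_length G S t \<le> length w"
  unfolding word_length_def by (rule Least_le) (use assms in blast)

lemma word_length_mult:
  assumes "s \<in> carrier G" "t \<in> carrier G"
  shows "word_length G S (s \<otimes> t) \<le> word_length G S s + word_length G S t"
proof -
  obtain u v where "length u = word_length G S s" "set u \<subseteq> S" "foldr (monoid.mult G) u \<one> = s"
    "length v = word_length G S t" "set v \<subseteq> S" "foldr (monoid.mult G) v \<one> = t"
    using word_length_witness assms by meson
  then show ?thesis using word_length_le[of "u @ v" "s \<otimes> t"] word_append[of u v] by simp
qed

lemma group_weight_power_word_length: "group_weight G (\<lambda>t. 2 ^ word_length G S t)"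
  unfolding group_weight_def
proof (intro conjI ballI)
  show "(2::real) ^ word_length G S \<one> = 1" using word_length_le[of "[]" \<one>] by simp
next
  fix s t assume "s \<in> carrier G" "t \<in> carrier G"
  then show "(2::real) ^ word_length G S (s \<otimes> t) \<le> 2 ^ word_length G S s * 2 ^ word_length G S t"
    using word_length_mult by (simp flip: power_add)
qed simp

end

lemma mat_monoid_monoid:
  assumes "ring K"
  shows "monoid (mat_monoid n K)"
proof -
  interpret ring K by fact
  let ?I = "{..<n} \<times> {..<n}"
  have swap: "(\<Oplus>\<^bsub>K\<^esub>i\<in>{..<m}. \<Oplus>\<^bsub>K\<^esub>j\<in>B. f i j) = (\<Oplus>\<^bsub>K\<^esub>j\<in>B. \<Oplus>\<^bsub>K\<^esub>i\<in>{..<m}. f i j)"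
    if f: "\<And>i j. i < m \<Longrightarrow> j \<in> B \<Longrightarrow> f i j \<in> carrier K" for m :: nat and B :: "nat set" and f
    using f
  proof (induction m)
    case 0 then show ?case by (simp add: finsum_zero)
  next
    case (Suc m)
    have *: "{..<Suc m} = insert m {..<m}" by auto
    have IH: "(\<Oplus>\<^bsub>K\<^esub>i\<in>{..<m}. \<Oplus>\<^bsub>K\<^esub>j\<in>B. f i j) = (\<Oplus>\<^bsub>K\<^esub>j\<in>B. \<Oplus>\<^bsub>K\<^esub>i\<in>{..<m}. f i j)"
      using Suc by simp
    have "(\<Oplus>\<^bsub>K\<^esub>i\<in>{..<Suc m}. \<Oplus>\<^bsub>K\<^esub>j\<in>B. f i j)
      = (\<Oplus>\<^bsub>K\<^esub>j\<in>B. f m j) \<oplus>\<^bsub>K\<^esub> (\<Oplus>\<^bsub>K\<^esub>i\<in>{..<m}. \<Oplus>\<^bsub>K\<^esub>j\<in>B. f i j)"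
      unfolding * using Suc.prems by (subst finsum_insert) auto
    also have "\<dots> = (\<Oplus>\<^bsub>K\<^esub>j\<in>B. f m j \<oplus>\<^bsub>K\<^esub> (\<Oplus>\<^bsub>K\<^esub>i\<in>{..<m}. f i j))"
      unfolding IH using Suc.prems by (subst finsum_addf) auto
    also have "\<dots> = (\<Oplus>\<^bsub>K\<^esub>j\<in>B. \<Oplus>\<^bsub>K\<^esub>i\<in>{..<Suc m}. f i j)"
      unfolding * using Suc.prems by (intro finsum_cong' refl) (auto intro!: finsum_closed)
    finally show ?case .
  qed
  have ent: "A (i, j) \<in> carrier K" if "A \<in> ?I \<rightarrow>\<^sub>E carrier K" "i < n" "j < n" for A i j
    using that by (auto simp: PiE_iff)
  have assoc: "(\<Oplus>\<^bsub>K\<^esub>k\<in>{..<n}. (\<Oplus>\<^bsub>K\<^esub>l\<in>{..<n}. A (i, l) \<otimes>\<^bsub>K\<^esub> B (l, k)) \<otimes>\<^bsub>K\<^esub> C (k, j))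
      = (\<Oplus>\<^bsub>K\<^esub>l\<in>{..<n}. A (i, l) \<otimes>\<^bsub>K\<^esub> (\<Oplus>\<^bsub>K\<^esub>k\<in>{..<n}. B (l, k) \<otimes>\<^bsub>K\<^esub> C (k, j)))"
    if A: "A \<in> ?I \<rightarrow>\<^sub>E carrier K" and B: "B \<in> ?I \<rightarrow>\<^sub>E carrier K"
      and C: "C \<in> ?I \<rightarrow>\<^sub>E carrier K" and ij: "i < n" "j < n" for A B C i j
  proof -
    note e = ent[OF A] ent[OF B] ent[OF C]
    have "(\<Oplus>\<^bsub>K\<^esub>k\<in>{..<n}. (\<Oplus>\<^bsub>K\<^esub>l\<in>{..<n}. A (i, l) \<otimes>\<^bsub>K\<^esub> B (l, k)) \<otimes>\<^bsub>K\<^esub> C (k, j))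
      = (\<Oplus>\<^bsub>K\<^esub>k\<in>{..<n}. \<Oplus>\<^bsub>K\<^esub>l\<in>{..<n}. A (i, l) \<otimes>\<^bsub>K\<^esub> B (l, k) \<otimes>\<^bsub>K\<^esub> C (k, j))"
      using e ij by (intro finsum_cong' refl finsum_ldistr) (auto intro!: finsum_closed)
    also have "\<dots> = (\<Oplus>\<^bsub>K\<^esub>l\<in>{..<n}. \<Oplus>\<^bsub>K\<^esub>k\<in>{..<n}. A (i, l) \<otimes>\<^bsub>K\<^esub> B (l, k) \<otimes>\<^bsub>K\<^esub> C (k, j))"
      using e ij by (intro swap) auto
    also have "\<dots> = (\<Oplus>\<^bsub>K\<^esub>l\<in>{..<n}. \<Oplus>\<^bsub>K\<^esub>k\<in>{..<n}. A (i, l) \<otimes>\<^bsub>K\<^esub> (B (l, k) \<otimes>\<^bsub>K\<^esub> C (k, j)))"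
      using e ij by (intro finsum_cong' refl) (auto intro!: finsum_closed m_assoc)
    also have "\<dots> = (\<Oplus>\<^bsub>K\<^esub>l\<in>{..<n}. A (i, l) \<otimes>\<^bsub>K\<^esub> (\<Oplus>\<^bsub>K\<^esub>k\<in>{..<n}. B (l, k) \<otimes>\<^bsub>K\<^esub> C (k, j)))"
      using e ij by (intro finsum_cong' refl finsum_rdistr[symmetric]) (auto intro!: finsum_closed)
    finally show ?thesis .
  qed
  have l1: "(\<Oplus>\<^bsub>K\<^esub>k\<in>{..<n}. (if i = k then \<one>\<^bsub>K\<^esub> else \<zero>\<^bsub>K\<^esub>) \<otimes>\<^bsub>K\<^esub> A (k, j)) = A (i, j)"
    if A: "A \<in> ?I \<rightarrow>\<^sub>E carrier K" and ij: "i < n" "j < n" for A i j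
  proof -
    have "(\<Oplus>\<^bsub>K\<^esub>k\<in>{..<n}. (if i = k then \<one>\<^bsub>K\<^esub> else \<zero>\<^bsub>K\<^esub>) \<otimes>\<^bsub>K\<^esub> A (k, j))
      = (\<Oplus>\<^bsub>K\<^esub>k\<in>{..<n}. if i = k then A (k, j) else \<zero>\<^bsub>K\<^esub>)"
      using ent[OF A] ij by (intro finsum_cong' refl) auto
    also have "\<dots> = A (i, j)"
      using ent[OF A] ij by (subst finsum_singleton[of i]) auto
    finally show ?thesis .
  qed
  have r1: "(\<Oplus>\<^bsub>K\<^esub>k\<in>{..<n}. A (i, k) \<otimes>\<^bsub>K\<^esub> (if k = j then \<one>\<^bsub>K\<^esub> else \<zero>\<^bsub>K\<^esub>)) = A (i, j)"
    if A: "A \<in> ?I \<rightarrow>\<^sub>E carrier K" and ij: "i < n" "j < n" for A i j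
  proof -
    have "(\<Oplus>\<^bsub>K\<^esub>k\<in>{..<n}. A (i, k) \<otimes>\<^bsub>K\<^esub> (if k = j then \<one>\<^bsub>K\<^esub> else \<zero>\<^bsub>K\<^esub>))
      = (\<Oplus>\<^bsub>K\<^esub>k\<in>{..<n}. if j = k then A (i, k) else \<zero>\<^bsub>K\<^esub>)"
      using ent[OF A] ij by (intro finsum_cong' refl) auto
    also have "\<dots> = A (i, j)"
      using ent[OF A] ij by (subst finsum_singleton[of j]) auto
    finally show ?thesis .
  qed
  show ?thesis
  proof (unfold_locales, goal_cases)
    case (1 A B)
    then have AB: "A \<in> ?I \<rightarrow>\<^sub>E carrier K" "B \<in> ?I \<rightarrow>\<^sub>E carrier K"
      by (simp_all add: mat_monoid_def)
    show ?case unfolding mat_monoid_def monoid.simps partial_object.simps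
    proof (rule restrict_PiE_iff[THEN iffD2], safe, goal_cases)
      case (1 i j)
      then show ?case using ent[OF AB(1)] ent[OF AB(2)] by (auto intro!: finsum_closed)
    qed
  next
    case (2 A B C)
    then have ABC: "A \<in> ?I \<rightarrow>\<^sub>E carrier K" "B \<in> ?I \<rightarrow>\<^sub>E carrier K" "C \<in> ?I \<rightarrow>\<^sub>E carrier K"
      by (auto simp: mat_monoid_def)
    note e = ent[OF ABC(1)] ent[OF ABC(2)] ent[OF ABC(3)]
    show ?case
      unfolding mat_monoid_def monoid.simps
    proof (rule restrict_ext, clarsimp, goal_cases)
      case (1 i j)
      have "(\<Oplus>\<^bsub>K\<^esub>k\<in>{..<n}. (\<lambda>(i, j) \<in> ?I. \<Oplus>\<^bsub>K\<^esub>k\<in>{..<n}. A (i, k) \<otimes>\<^bsub>K\<^esub> B (k, j)) (i, k) \<otimes>\<^bsub>K\<^esub> C (k, j))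
        = (\<Oplus>\<^bsub>K\<^esub>k\<in>{..<n}. (\<Oplus>\<^bsub>K\<^esub>l\<in>{..<n}. A (i, l) \<otimes>\<^bsub>K\<^esub> B (l, k)) \<otimes>\<^bsub>K\<^esub> C (k, j))"
        using 1 e by (intro finsum_cong' refl) (auto intro!: finsum_closed)
      also have "\<dots> = (\<Oplus>\<^bsub>K\<^esub>l\<in>{..<n}. A (i, l) \<otimes>\<^bsub>K\<^esub> (\<Oplus>\<^bsub>K\<^esub>k\<in>{..<n}. B (l, k) \<otimes>\<^bsub>K\<^esub> C (k, j)))"
        using 1 by (intro assoc ABC)
      also have "\<dots> = (\<Oplus>\<^bsub>K\<^esub>l\<in>{..<n}. A (i, l) \<otimes>\<^bsub>K\<^esub>
          (\<lambda>(i, j) \<in> ?I. \<Oplus>\<^bsub>K\<^esub>k\<in>{..<n}. B (i, k) \<otimes>\<^bsub>K\<^esub> C (k, j)) (l, j))"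
        using 1 e by (intro finsum_cong' refl) (auto intro!: finsum_closed)
      finally show ?case using 1 by (simp cong: if_cong)
    qed
  next
    case 3 show ?case by (auto simp: mat_monoid_def)
  next
    case (4 A)
    then have A: "A \<in> ?I \<rightarrow>\<^sub>E carrier K" by (simp add: mat_monoid_def)
    show ?case unfolding mat_monoid_def monoid.simps
    proof (rule extensionalityI[of _ ?I])
      fix p assume p: "p \<in> ?I"
      obtain i j where ij: "p = (i, j)" "i < n" "j < n" using p by auto
      have "(\<Oplus>\<^bsub>K\<^esub>k\<in>{..<n}. (\<lambda>(i, j) \<in> ?I. if i = j then \<one>\<^bsub>K\<^esub> else \<zero>\<^bsub>K\<^esub>) (i, k) \<otimes>\<^bsub>K\<^esub> A (k, j))
        = (\<Oplus>\<^bsub>K\<^esub>k\<in>{..<n}. (if i = k then \<one>\<^bsub>K\<^esub> else \<zero>\<^bsub>K\<^esub>) \<otimes>\<^bsub>K\<^esub> A (k, j))"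
        using ij ent[OF A] by (intro finsum_cong' refl) auto
      then show "(\<lambda>(i, j) \<in> ?I. \<Oplus>\<^bsub>K\<^esub>k\<in>{..<n}.
          (\<lambda>(i, j) \<in> ?I. if i = j then \<one>\<^bsub>K\<^esub> else \<zero>\<^bsub>K\<^esub>) (i, k) \<otimes>\<^bsub>K\<^esub> A (k, j)) p = A p"
        using ij l1[OF A] by simp
    qed (use A in \<open>auto simp: PiE_iff\<close>)
  next
    case (5 A)
    then have A: "A \<in> ?I \<rightarrow>\<^sub>E carrier K" by (simp add: mat_monoid_def)
    show ?case unfolding mat_monoid_def monoid.simps
    proof (rule extensionalityI[of _ ?I])
      fix p assume p: "p \<in> ?I"
      obtain i j where ij: "p = (i, j)" "i < n" "j < n" using p by auto
      have "(\<Oplus>\<^bsub>K\<^esub>k\<in>{..<n}. A (i, k) \<otimes>\<^bsub>K\<^esub> (\<lambda>(i, j) \<in> ?I. if i = j then \<one>\<^bsub>K\<^esub> else \<zero>\<^bsub>K\<^esub>) (k, j))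
        = (\<Oplus>\<^bsub>K\<^esub>k\<in>{..<n}. A (i, k) \<otimes>\<^bsub>K\<^esub> (if k = j then \<one>\<^bsub>K\<^esub> else \<zero>\<^bsub>K\<^esub>))"
        using ij ent[OF A] by (intro finsum_cong' refl) auto
      then show "(\<lambda>(i, j) \<in> ?I. \<Oplus>\<^bsub>K\<^esub>k\<in>{..<n}.
          A (i, k) \<otimes>\<^bsub>K\<^esub> (\<lambda>(i, j) \<in> ?I. if i = j then \<one>\<^bsub>K\<^esub> else \<zero>\<^bsub>K\<^esub>) (k, j)) p = A p"
        using ij r1[OF A] by simp
    qed (use A in \<open>auto simp: PiE_iff\<close>)
  qed
qed

lemma GL_group: "ring K \<Longrightarrow> group (GL n K)"
  unfolding GL_def by (intro monoid.units_group mat_monoid_monoid)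

lemma linear_overI:
  fixes K :: "'k ring"
  assumes "group G" "field K" "h \<in> hom G (GL n K)" "inj_on h (carrier G)"
  shows "linear_over TYPE('k) G"
proof -
  interpret K: field K by fact
  interpret h: group_hom G "GL n K" h
    using assms(1,3) GL_group[OF K.ring_axioms]
    by (simp add: group_hom_def group_hom_axioms_def)
  have "h \<in> iso G ((GL n K)\<lparr>carrier := h ` carrier G\<rparr>)"
    using assms(3,4) by (auto simp: iso_def hom_def bij_betw_def)
  then show ?thesis
    unfolding linear_over_def using assms(2) h.img_is_subgroup is_isoI by blast
qed

lemma linear_overE:
  assumes "linear_over TYPE('k) G"
  obtains n and K :: "'k ring" and h
  where "field K" "h \<in> hom G (GL n K)" "inj_on h (carrier G)"
proof -
  obtain n and K :: "'k ring" and H h where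
    *: "field K" "subgroup H (GL n K)" "h \<in> iso G ((GL n K)\<lparr>carrier := H\<rparr>)"
    using assms unfolding linear_over_def is_iso_def by blast
  have "h \<in> hom G (GL n K)" "inj_on h (carrier G)"
    using *(3) subgroup.subset[OF *(2)] by (auto simp: iso_def hom_def bij_betw_def)
  then show thesis using *(1) that by blast
qed

lemma countable_generate_field:
  assumes "countable S"
  shows "countable (generate_field K S)"
proof -
  define step where "step T = insert \<one>\<^bsub>K\<^esub> (T \<union> a_inv K ` T \<union> m_inv K ` T
    \<union> case_prod (ring.add K) ` (T \<times> T) \<union> case_prod (monoid.mult K) ` (T \<times> T))" for T
  define U where "U n = (step ^^ n) S" for n
  have U_Suc: "U (Suc n) = step (U n)" for n by (simp add: U_def)
  have cU: "countable (U n)" for n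
    by (induction n) (use assms in \<open>auto simp: U_Suc step_def U_def\<close>)
  have mono: "U m \<subseteq> U n" if "m \<le> n" for m n
    using that by (rule lift_Suc_mono_le[rotated]) (auto simp: U_Suc step_def)
  have "x \<in> (\<Union>n. U n)" if "x \<in> generate_field K S" for x
    using that
  proof induction
    case one then show ?case by (intro UN_I[of 1]) (auto simp: U_def step_def)
  next
    case (incl h) then show ?case by (intro UN_I[of 0]) (auto simp: U_def)
  next
    case (a_inv h)
    then obtain n where "h \<in> U n" by blast
    then show ?case by (intro UN_I[of "Suc n"]) (auto simp: U_Suc step_def)
  next
    case (m_inv h)
    then obtain n where "h \<in> U n" by blast
    then show ?case by (intro UN_I[of "Suc n"]) (auto simp: U_Suc step_def)
  next
    case (eng_add a b)
    then obtain m n where "a \<in> U m" "b \<in> U n" by blast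
    then have "a \<in> U (max m n)" "b \<in> U (max m n)" using mono[of m "max m n"] mono[of n "max m n"] by auto
    then show ?case by (intro UN_I[of "Suc (max m n)"]) (auto simp: U_Suc step_def)
  next
    case (eng_mult a b)
    then obtain m n where "a \<in> U m" "b \<in> U n" by blast
    then have "a \<in> U (max m n)" "b \<in> U (max m n)" using mono[of m "max m n"] mono[of n "max m n"] by auto
    then show ?case by (intro UN_I[of "Suc (max m n)"]) (auto simp: U_Suc step_def)
  qed
  then show ?thesis by (meson cU countable_UN countable_subset subsetI countableI_type)
qed

theorem linear_over_imp_linear_group:
  assumes "group G" "countable (carrier G)" "linear_over TYPE('k) G"
  shows "linear_group G"
proof -
  obtain n and K :: "'k ring" and h where K: "field K" and h: "h \<in> hom G (GL n K)"
    and inj: "inj_on h (carrier G)"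
    using assms(3) by (rule linear_overE)
  interpret G: group G by fact
  interpret K: field K by fact
  interpret M: monoid "mat_monoid n K" by (rule mat_monoid_monoid[OF K.ring_axioms])
  interpret gh: group_hom G "GL n K" h
    using assms(1) h GL_group[OF K.ring_axioms] by (simp add: group_hom_def group_hom_axioms_def)
  let ?I = "{..<n} \<times> {..<n}"
  have h_mult: "h (a \<otimes>\<^bsub>G\<^esub> b) = h a \<otimes>\<^bsub>mat_monoid n K\<^esub> h b" if "a \<in> carrier G" "b \<in> carrier G" for a b
    using gh.hom_mult[OF that] by (simp add: GL_def units_of_def)
  have h_one: "h \<one>\<^bsub>G\<^esub> = \<one>\<^bsub>mat_monoid n K\<^esub>"
    using gh.hom_one by (simp add: GL_def units_of_def)
  have hM: "h a \<in> ?I \<rightarrow>\<^sub>E carrier K" if "a \<in> carrier G" for a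
    using gh.hom_closed[OF that] by (simp add: GL_def units_of_def Units_def mat_monoid_def)
  define S where "S = (\<Union>a\<in>carrier G. h a ` ?I)"
  define F where "F = generate_field K S"
  have S: "S \<subseteq> carrier K" "countable S"
    using hM assms(2) by (fastforce simp: S_def, auto simp: S_def intro!: countable_UN)
  have "countable F" unfolding F_def by (rule countable_generate_field[OF S(2)])
  then obtain e :: "'k \<Rightarrow> nat" where e: "inj_on e F" unfolding countable_def by blast
  define KF where "KF = K\<lparr>carrier := F\<rparr>"
  interpret KF: field KF unfolding KF_def F_def by (rule K.generate_field_is_field[OF S(1)])
  have e': "inj_on e (carrier KF)" using e by (simp add: KF_def)
  define L where "L = image_ring e KF"
  interpret L: field L unfolding L_def by (rule KF.inj_imp_image_ring_is_field[OF e'])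
  have SF: "S \<subseteq> F" unfolding F_def by (blast intro: generate_field.incl)
  have FK: "F \<subseteq> carrier K" unfolding F_def using K.generate_field_in_carrier[OF S(1)] by blast
  define d where "d = inv_into F e"
  have "d \<in> ring_iso L KF"
    using ring_iso_set_sym[OF KF.ring_axioms inj_imp_image_ring_iso[OF e']]
    by (simp add: d_def L_def KF_def)
  then have dhom: "d \<in> ring_hom L K" and dinj: "inj_on d (carrier L)"
    using FK by (auto simp: ring_iso_def ring_hom_def KF_def bij_betw_def)
  interpret d: ring_hom_ring L K d
    by (rule ring_hom_ringI2[OF L.ring_axioms K.ring_axioms dhom])
  have de: "d (e x) = x" if "x \<in> F" for x using that e by (simp add: d_def)
  have eL: "e x \<in> carrier L" if "x \<in> F" for x
    using that by (simp add: L_def image_ring_carrier KF_def)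
  have hF: "h a (i, j) \<in> F" if "a \<in> carrier G" "i < n" "j < n" for a i j
    using that SF by (auto simp: S_def)
  define g where "g a = (\<lambda>p\<in>?I. e (h a p))" for a
  have gM: "g a \<in> carrier (mat_monoid n L)" if "a \<in> carrier G" for a
    using that hF eL by (auto simp: g_def mat_monoid_def)
  have g_mult: "g (a \<otimes>\<^bsub>G\<^esub> b) = g a \<otimes>\<^bsub>mat_monoid n L\<^esub> g b" if ab: "a \<in> carrier G" "b \<in> carrier G" for a b
  proof (rule extensionalityI[of _ ?I])
    fix p assume "p \<in> ?I"
    then obtain i j where ij: "p = (i, j)" "i < n" "j < n" by auto
    have gc: "g a (i, k) \<in> carrier L" "g b (k, j) \<in> carrier L" if "k < n" for k
      using that ij ab eL hF by (auto simp: g_def)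
    have "d ((g a \<otimes>\<^bsub>mat_monoid n L\<^esub> g b) p) = d (\<Oplus>\<^bsub>L\<^esub>k\<in>{..<n}. g a (i, k) \<otimes>\<^bsub>L\<^esub> g b (k, j))"
      using ij by (simp add: mat_monoid_def)
    also have "\<dots> = (\<Oplus>\<^bsub>K\<^esub>k\<in>{..<n}. d (g a (i, k) \<otimes>\<^bsub>L\<^esub> g b (k, j)))"
      using gc by (subst d.hom_finsum) (auto simp: o_def)
    also have "\<dots> = (\<Oplus>\<^bsub>K\<^esub>k\<in>{..<n}. h a (i, k) \<otimes>\<^bsub>K\<^esub> h b (k, j))"
    proof (rule K.finsum_cong'[OF refl])
      show "(\<lambda>k. h a (i, k) \<otimes>\<^bsub>K\<^esub> h b (k, j)) \<in> {..<n} \<rightarrow> carrier K"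
        using hF ab ij FK by (auto intro!: K.m_closed)
      fix k assume "k \<in> {..<n}"
      then show "d (g a (i, k) \<otimes>\<^bsub>L\<^esub> g b (k, j)) = h a (i, k) \<otimes>\<^bsub>K\<^esub> h b (k, j)"
        using gc[of k] ij ab hF de by (simp add: g_def)
    qed
    also have "\<dots> = h (a \<otimes>\<^bsub>G\<^esub> b) (i, j)"
      unfolding h_mult[OF ab] using ij by (simp add: mat_monoid_def)
    also have "\<dots> = d (g (a \<otimes>\<^bsub>G\<^esub> b) p)"
      using ij ab hF[of "a \<otimes>\<^bsub>G\<^esub> b" i j] de by (simp add: g_def del: gh.hom_mult)
    finally have eq: "d (g (a \<otimes>\<^bsub>G\<^esub> b) p) = d ((g a \<otimes>\<^bsub>mat_monoid n L\<^esub> g b) p)" by simp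
    have "g (a \<otimes>\<^bsub>G\<^esub> b) p \<in> carrier L" "(g a \<otimes>\<^bsub>mat_monoid n L\<^esub> g b) p \<in> carrier L"
      using ij ab gc eL hF[of "a \<otimes>\<^bsub>G\<^esub> b" i j]
      by (auto simp: g_def mat_monoid_def simp del: gh.hom_mult intro!: L.finsum_closed)
    then show "g (a \<otimes>\<^bsub>G\<^esub> b) p = (g a \<otimes>\<^bsub>mat_monoid n L\<^esub> g b) p"
      using eq dinj by (simp add: inj_on_eq_iff)
  qed (auto simp: g_def mat_monoid_def)
  have g_one: "g \<one>\<^bsub>G\<^esub> = \<one>\<^bsub>mat_monoid n L\<^esub>"
    unfolding g_def h_one
    by (auto simp: mat_monoid_def L_def KF_def image_ring_one image_ring_zero intro!: restrict_ext)
  have gU: "g a \<in> Units (mat_monoid n L)" if a: "a \<in> carrier G" for a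
    unfolding Units_def using a gM[of a] gM[of "inv\<^bsub>G\<^esub> a"] g_one
    by (auto simp flip: g_mult intro!: bexI[of _ "g (inv\<^bsub>G\<^esub> a)"])
  have "g \<in> hom G (GL n L)"
    using gU g_mult by (auto simp: hom_def GL_def units_of_def)
  moreover have "inj_on g (carrier G)"
  proof (rule inj_onI)
    fix a b assume ab: "a \<in> carrier G" "b \<in> carrier G" and eq: "g a = g b"
    have "h a = h b"
    proof (rule extensionalityI[of _ ?I])
      fix p assume p: "p \<in> ?I"
      then have "e (h a p) = e (h b p)" using fun_cong[OF eq, of p] by (simp add: g_def)
      then show "h a p = h b p" using p ab hF e by (auto simp: inj_on_eq_iff)
    qed (use hM ab in \<open>auto simp: PiE_iff\<close>)
    then show "a = b" using inj ab by (simp add: inj_on_eq_iff)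
  qed
  ultimately show ?thesis
    unfolding linear_group_def using linear_overI[OF assms(1) L.field_axioms] by blast
qed

end

theory Submission
  imports Defs "HOL-Library.Function_Algebras" "HOL-Algebra.Algebraic_Closure_Type"
begin

text \<open>
  Write \<open>A\<close> for the Beurling algebra of \<open>G\<close>. It contains the point masses \<open>delta g\<close>, whose linear
  span is dense, and \<open>delta g\<close> acts on \<open>A\<close> from the left by translation.

  Separation of points by maximal left ideals comes from residual finiteness. If \<open>f t0 \<noteq> 0\<close>, all but
  finitely many values of \<open>f\<close> have total mass below the norm of \<open>f t0\<close>, so for a suitable finite
  quotient \<open>Q\<close> of \<open>G\<close> the sum of \<open>f\<close> over the coset of \<open>t0\<close> is not zero. The algebra acts on the
  finite-dimensional space of functions on \<open>Q\<close>, and translations of \<open>Q\<close> preserve the inner product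
  of that space. Inside the submodule generated by the conjugate of the coset sums of \<open>f\<close>, take a
  minimal nonzero submodule. It cannot be killed by \<open>f\<close>: otherwise it would be orthogonal to a submodule that
  contains it. The annihilator of a vector that \<open>f\<close> does not kill is a maximal left ideal of finite
  codimension, because the module is simple, and it misses \<open>f\<close>
  (\<open>annihilator_maximal\<close>, \<open>separating_simple_submod\<close>).

  For finite generation let \<open>I\<close> be a left ideal of finite codimension. The group acts linearly on the
  finite-dimensional space \<open>A / I\<close>. As \<open>G\<close> is not linear, this action has a nontrivial kernel \<open>N\<close>,
  and as \<open>G\<close> is just infinite, \<open>N\<close> has finite index (\<open>trivially_acting_normal_subgroup\<close>). Hence
  \<open>delta s - delta s'\<close> lies in \<open>I\<close> whenever \<open>s\<close> and \<open>s'\<close> are in the same coset of \<open>N\<close>. Choose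
  a finite set \<open>T\<close> of coset representatives, \<open>r t\<close> being the one of \<open>t\<close>. Only finitely many of
  these differences are needed, namely \<open>delta (x u) - delta (r (x u))\<close> with \<open>x\<close> in the generating set
  and \<open>u\<close> in \<open>T\<close>: for a word \<open>t = x1 ... xk\<close> with suffixes \<open>sj = x(j+1) ... xk\<close> the telescoping sum
  of \<open>delta (x1 ... x(j-1)) * (delta (xj (r sj)) - delta (r s(j-1)))\<close> over \<open>j\<close> equals
  \<open>delta t - delta (r t)\<close>, and its left factors have total weight at most \<open>1 + 2 + ... + 2^(k-1) < 2^k\<close>. If the word is geodesic this
  is at most the weight of \<open>t\<close>, so these identities may be summed with the coefficients \<open>f t\<close> of an
  arbitrary \<open>f\<close> in \<open>A\<close>. Exponential growth of the weight is what makes this work. Thus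
  \<open>A\<close> is the sum of the left ideal generated by the chosen differences and of the finite-dimensional
  span of the point masses at \<open>T\<close> (\<open>decomposition_along_retraction\<close>), and \<open>I\<close> is generated by the
  differences together with a basis of its intersection with that span.
\<close>

section \<open>Linear algebra and infinite sums\<close>

lemma (in vector_space) subspace_finite_basis:
  assumes "subspace W" "W \<subseteq> span T" "finite T"
  obtains B where "finite B" "B \<subseteq> W" "independent B" "W = span B"
proof -
  obtain B where B: "B \<subseteq> W" "independent B" "W \<subseteq> span B" by (rule basis_exists)
  have "finite B" using independent_span_bound[OF assms(3) B(2)] B(1) assms(2) by auto
  moreover have "W = span B" using B span_minimal[OF B(1) assms(1)] by auto
  ultimately show ?thesis using B that by blast
qed

lemma (in vector_space) dim_subspace_less:
  assumes "subspace V" "subspace W" "V \<subset> W" "W \<subseteq> span T" "finite T"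
  shows "dim V < dim W"
proof -
  obtain B where B: "finite B" "B \<subseteq> V" "independent B" "V = span B"
    by (rule subspace_finite_basis[OF assms(1) _ assms(5)]) (use assms in auto)
  obtain D where D: "finite D" "D \<subseteq> W" "independent D" "W = span D"
    by (rule subspace_finite_basis[OF assms(2,4,5)])
  obtain x where x: "x \<in> W" "x \<notin> V" using assms(3) by auto
  have "independent (insert x B)"
    using B x independent_insertI by auto
  moreover have "insert x B \<subseteq> span D" using B x D assms(3) by auto
  ultimately have "card (insert x B) \<le> card D" using independent_span_bound[OF D(1)] by auto
  moreover have "card (insert x B) = Suc (card B)" using B x span_superset by (subst card_insert_disjoint) auto
  moreover have "dim V = card B" "dim W = card D"
    using B D dim_span_eq_card_independent by auto
  ultimately show ?thesis by simp
qed

text \<open>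
  The vectors in \<open>B\<close> represent a basis of the quotient by \<open>I\<close>, and \<open>\<phi> b\<close> is the coordinate functional of
  \<open>b\<close>. Working with coordinates avoids constructing the quotient space.
\<close>
lemma (in vector_space) coordinates_mod_subspace:
  assumes I: "subspace I" and fin: "finite B0"
  obtains B \<phi> where "finite B" "B \<subseteq> B0"
    "\<And>b x y. x \<in> span (I \<union> B0) \<Longrightarrow> y \<in> span (I \<union> B0) \<Longrightarrow> \<phi> b (x + y) = \<phi> b x + \<phi> b y"
    "\<And>b c x. x \<in> span (I \<union> B0) \<Longrightarrow> \<phi> b (scale c x) = c * \<phi> b x"
    "\<And>b x. b \<in> B \<Longrightarrow> x \<in> I \<Longrightarrow> \<phi> b x = 0"
    "\<And>b b'. b \<in> B \<Longrightarrow> b' \<in> B \<Longrightarrow> \<phi> b b' = (if b = b' then 1 else 0)"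
    "\<And>x. x \<in> span (I \<union> B0) \<Longrightarrow> x - (\<Sum>b\<in>B. scale (\<phi> b x) b) \<in> I"
proof -
  \<comment> \<open>Extend a basis \<open>D\<close> of \<open>I\<close> by elements of \<open>B0\<close>; the added vectors represent a basis of the quotient.\<close>
  obtain D where D: "D \<subseteq> I" "independent D" "I \<subseteq> span D"
    by (rule basis_exists)
  have spanD: "span D = I" using D span_minimal[OF D(1) I] by auto
  obtain E where E: "D \<subseteq> E" "E \<subseteq> D \<union> B0" "independent E" "D \<union> B0 \<subseteq> span E"
    using maximal_independent_subset_extend[of D "D \<union> B0"] D(2) by auto
  define B where "B = E - D"
  have B: "finite B" "B \<subseteq> B0" using E fin by (auto simp: B_def intro: finite_subset[of _ B0])
  have "I \<subseteq> span E" using D(3) span_mono[OF E(1)] by auto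
  then have VE: "span (I \<union> B0) \<subseteq> span E"
    using E(4) by (intro span_minimal subspace_span) auto
  define \<phi> where "\<phi> b x = representation E x b" for b x
  show ?thesis
  proof (rule that[OF B, of \<phi>])
    show "\<phi> b (x + y) = \<phi> b x + \<phi> b y" if "x \<in> span (I \<union> B0)" "y \<in> span (I \<union> B0)" for b x y
      using subsetD[OF VE that(1)] subsetD[OF VE that(2)]
      by (simp add: \<phi>_def representation_add[OF E(3)])
    show "\<phi> b (scale c x) = c * \<phi> b x" if "x \<in> span (I \<union> B0)" for b c x
      using that VE E(3) by (auto simp: \<phi>_def representation_scale)
    show "\<phi> b x = 0" if "b \<in> B" "x \<in> I" for b x
    proof -
      have "representation E x = representation D x"
        using representation_extend[OF E(3) _ E(1)] that(2) spanD by auto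
      then show ?thesis unfolding \<phi>_def
        using representation_ne_zero[of D x b] that(1) by (auto simp: B_def)
    qed
    show "\<phi> b b' = (if b = b' then 1 else 0)" if "b \<in> B" "b' \<in> B" for b b'
      using that representation_basis[OF E(3)] by (auto simp: \<phi>_def B_def)
    show "x - (\<Sum>b\<in>B. scale (\<phi> b x) b) \<in> I" if "x \<in> span (I \<union> B0)" for x
    proof -
      let ?F = "{b. representation E x b \<noteq> 0}"
      have fin: "finite ?F" by (rule finite_representation)
      have FE: "?F \<subseteq> E" using representation_ne_zero by auto
      have "x = (\<Sum>b\<in>?F. scale (\<phi> b x) b)"
        using sum_nonzero_representation_eq[OF E(3)] that VE by (auto simp: \<phi>_def)
      also have "\<dots> = (\<Sum>b\<in>?F \<inter> B. scale (\<phi> b x) b) + (\<Sum>b\<in>?F - B. scale (\<phi> b x) b)"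
        by (rule sum.Int_Diff[OF fin])
      also have "(\<Sum>b\<in>?F \<inter> B. scale (\<phi> b x) b) = (\<Sum>b\<in>B. scale (\<phi> b x) b)"
        using B(1) by (intro sum.mono_neutral_left) (auto simp: \<phi>_def)
      finally have "x = (\<Sum>b\<in>B. scale (\<phi> b x) b) + (\<Sum>b\<in>?F - B. scale (\<phi> b x) b)" .
      then have "x - (\<Sum>b\<in>B. scale (\<phi> b x) b) = (\<Sum>b\<in>?F - B. scale (\<phi> b x) b)"
        unfolding diff_eq_eq by (subst add.commute)
      moreover have "(\<Sum>b\<in>?F - B. scale (\<phi> b x) b) \<in> I"
        using FE D(1) by (intro subspace_sum[OF I] subspace_scale[OF I]) (auto simp: B_def)
      ultimately show ?thesis by simp
    qed
  qed
qed

interpretation fn: vector_space "\<lambda>(c::complex) (f::'x \<Rightarrow> complex) t. c * f t"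
  by unfold_locales (auto simp: fun_eq_iff algebra_simps)

lemma sum_fun_apply: "(\<Sum>b\<in>B. F b) t = (\<Sum>b\<in>B. F b t)" for F :: "'i \<Rightarrow> 'x \<Rightarrow> complex"
  by (induction B rule: infinite_finite_induct) auto

lemma abs_summable_on_swap:
  fixes F :: "'i \<times> 'j \<Rightarrow> complex"
  assumes "F abs_summable_on I \<times> J"
  shows "(\<lambda>(j, i). F (i, j)) abs_summable_on J \<times> I"
  using assms summable_on_swap[of "\<lambda>x. norm (F x)" I J]
  by (simp add: case_prod_unfold prod.swap_def o_def)

lemma summable_on_sum:
  fixes f :: "'i \<Rightarrow> 'x \<Rightarrow> complex"
  assumes "finite K" "\<And>x. x \<in> K \<Longrightarrow> f x summable_on D"
  shows "(\<lambda>s. \<Sum>x\<in>K. f x s) summable_on D"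
    and "(\<Sum>\<^sub>\<infinity>s\<in>D. \<Sum>x\<in>K. f x s) = (\<Sum>x\<in>K. infsum (f x) D)"
proof -
  have "(\<lambda>s. \<Sum>x\<in>K. f x s) summable_on D \<and> (\<Sum>\<^sub>\<infinity>s\<in>D. \<Sum>x\<in>K. f x s) = (\<Sum>x\<in>K. infsum (f x) D)"
    using assms
  proof (induction K rule: finite_induct)
    case (insert x K)
    then show ?case using summable_on_add[of "f x" D "\<lambda>s. \<Sum>x\<in>K. f x s"]
        infsum_add[of "f x" D "\<lambda>s. \<Sum>x\<in>K. f x s"] by simp
  qed simp
  then show "(\<lambda>s. \<Sum>x\<in>K. f x s) summable_on D"
    "(\<Sum>\<^sub>\<infinity>s\<in>D. \<Sum>x\<in>K. f x s) = (\<Sum>x\<in>K. infsum (f x) D)" by auto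
qed

lemma infsum_point:
  fixes F :: "'x \<Rightarrow> complex"
  assumes "\<And>s. s \<in> D \<Longrightarrow> s \<noteq> x \<Longrightarrow> F s = 0"
  shows "infsum F D = (if x \<in> D then F x else 0)"
proof -
  have "infsum F D = infsum F (D \<inter> {x})"
    by (rule infsum_cong_neutral) (use assms in auto)
  then show ?thesis by simp
qed

section \<open>Convolution in a Beurling algebra\<close>

locale weighted_group = group G for G :: "('a, 'b) monoid_scheme" (structure) +
  fixes \<omega> :: "'a \<Rightarrow> real"
  assumes weight: "group_weight G \<omega>"
begin

abbreviation A :: "(complex, 'a \<Rightarrow> complex) module" where
  "A \<equiv> beurling G \<omega>"

definition wnorm :: "('a \<Rightarrow> complex) \<Rightarrow> real" where
  "wnorm f = (\<Sum>\<^sub>\<infinity>t\<in>carrier G. norm (f t) * \<omega> t)"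

definition delta :: "'a \<Rightarrow> 'a \<Rightarrow> complex" where
  "delta g = (\<lambda>t. if t = g then 1 else 0)"

text \<open>
  Left translation, that is, convolution by the point mass at \<open>g\<close> from the left.
\<close>
definition shift :: "'a \<Rightarrow> ('a \<Rightarrow> complex) \<Rightarrow> 'a \<Rightarrow> complex" where
  "shift g f = (\<lambda>t. if t \<in> carrier G then f (inv g \<otimes> t) else 0)"

lemma weight_ge_1: "t \<in> carrier G \<Longrightarrow> 1 \<le> \<omega> t"
  and weight_mult: "s \<in> carrier G \<Longrightarrow> t \<in> carrier G \<Longrightarrow> \<omega> (s \<otimes> t) \<le> \<omega> s * \<omega> t"
  using weight unfolding group_weight_def by auto

lemma wnorm_nonneg: "0 \<le> wnorm f"
  unfolding wnorm_def
  by (intro infsum_nonneg mult_nonneg_nonneg norm_ge_zero order_trans[OF zero_le_one weight_ge_1])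

lemma carrier_iff:
  "f \<in> carrier A \<longleftrightarrow>
    (\<forall>t. t \<notin> carrier G \<longrightarrow> f t = 0) \<and> (\<lambda>t. norm (f t) * \<omega> t) summable_on carrier G"
  by (simp add: beurling_def)

lemma zero_off: "f \<in> carrier A \<Longrightarrow> t \<notin> carrier G \<Longrightarrow> f t = 0"
  by (simp add: carrier_iff)

lemma summable_weighted: "f \<in> carrier A \<Longrightarrow> (\<lambda>t. norm (f t) * \<omega> t) summable_on carrier G"
  by (simp add: carrier_iff)

lemma summable_bounded:
  assumes "f \<in> carrier A" "\<And>t. t \<in> carrier G \<Longrightarrow> norm (\<phi> t :: complex) \<le> C"
  shows "(\<lambda>t. f t * \<phi> t) abs_summable_on carrier G"
proof (rule abs_summable_on_comparison_test')
  show "(\<lambda>t. C * (norm (f t) * \<omega> t)) summable_on carrier G"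
    using summable_weighted[OF assms(1)] by (rule summable_on_cmult_right)
  fix t assume t: "t \<in> carrier G"
  have "norm (f t) * norm (\<phi> t) \<le> (norm (f t) * \<omega> t) * C"
    using assms(2)[OF t] weight_ge_1[OF t]
    by (intro mult_mono) (auto simp: mult_le_cancel_left1)
  then show "norm (f t * \<phi> t) \<le> C * (norm (f t) * \<omega> t)"
    by (simp add: norm_mult mult_ac)
qed

text \<open>
  Superposing a family of elements \<open>c i\<close> with coefficients \<open>f i\<close> is the common pattern behind
  convolution (superposition of translates) and behind the left factors constructed from words. The three
  lemmas on superpositions are Fubini arguments resting on this double summability.
\<close>
lemma superposition_abs_summable:
  assumes "\<And>i. i \<in> I \<Longrightarrow> c i \<in> carrier A"
    and "(\<lambda>i. norm (f i :: complex) * wnorm (c i)) summable_on I"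
  shows "(\<lambda>(i, t). f i * c i t * of_real (\<omega> t)) abs_summable_on I \<times> carrier G"
proof (subst abs_summable_on_Sigma_iff, intro conjI ballI)
  have n: "norm (f i * c i t * of_real (\<omega> t)) = norm (f i) * (norm (c i t) * \<omega> t)"
    if "t \<in> carrier G" for i t
    using weight_ge_1[OF that] by (simp add: norm_mult)
  show "(\<lambda>t. case (i, t) of (i, t) \<Rightarrow> f i * c i t * of_real (\<omega> t)) abs_summable_on carrier G"
    if "i \<in> I" for i
    using summable_on_cmult_right[OF summable_weighted[OF assms(1)[OF that]], of "norm (f i)"]
    by (simp add: n cong: summable_on_cong)
  have "norm (\<Sum>\<^sub>\<infinity>t\<in>carrier G. norm (case (i, t) of (i, t) \<Rightarrow> f i * c i t * of_real (\<omega> t)))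
      = norm (f i) * wnorm (c i)" for i
    using wnorm_nonneg[of "c i"] by (simp add: n wnorm_def infsum_cmult_right' abs_mult cong: infsum_cong)
  then show "(\<lambda>i. \<Sum>\<^sub>\<infinity>t\<in>carrier G. norm (case (i, t) of (i, t) \<Rightarrow> f i * c i t * of_real (\<omega> t)))
      abs_summable_on I"
    using assms(2) by simp
qed

lemma superposition_closed:
  assumes "\<And>i. i \<in> I \<Longrightarrow> c i \<in> carrier A"
    and "(\<lambda>i. norm (f i :: complex) * wnorm (c i)) summable_on I"
  shows "(\<lambda>t. \<Sum>\<^sub>\<infinity>i\<in>I. f i * c i t) \<in> carrier A"
  unfolding carrier_iff
proof (intro conjI allI impI)
  fix t assume "t \<notin> carrier G"
  then show "(\<Sum>\<^sub>\<infinity>i\<in>I. f i * c i t) = 0"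
    using zero_off[OF assms(1)] by (intro infsum_0) auto
next
  have n: "norm (f i * c i t * of_real (\<omega> t)) = norm (f i * c i t) * \<omega> t" if "t \<in> carrier G" for i t
    using weight_ge_1[OF that] by (simp add: norm_mult)
  have sw: "(\<lambda>(t, i). f i * c i t * of_real (\<omega> t)) abs_summable_on carrier G \<times> I"
    using abs_summable_on_swap[OF superposition_abs_summable[OF assms]] by simp
  have s: "(\<lambda>i. f i * c i t * of_real (\<omega> t)) abs_summable_on I" if "t \<in> carrier G" for t
    using iffD1[OF abs_summable_on_Sigma_iff sw] that by simp
  have "(\<lambda>t. \<Sum>\<^sub>\<infinity>i\<in>I. norm (f i * c i t * of_real (\<omega> t))) abs_summable_on carrier G"
    using iffD1[OF abs_summable_on_Sigma_iff sw] by simp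
  then have sn: "(\<lambda>t. \<Sum>\<^sub>\<infinity>i\<in>I. norm (f i * c i t * of_real (\<omega> t))) summable_on carrier G"
    by (rule abs_summable_summable)
  show "(\<lambda>t. norm (\<Sum>\<^sub>\<infinity>i\<in>I. f i * c i t) * \<omega> t) summable_on carrier G"
  proof (rule summable_on_comparison_test)
    show "(\<lambda>t. \<Sum>\<^sub>\<infinity>i\<in>I. norm (f i * c i t * of_real (\<omega> t))) summable_on carrier G"
      by (rule sn)
    fix t assume t: "t \<in> carrier G"
    have "norm (\<Sum>\<^sub>\<infinity>i\<in>I. f i * c i t * of_real (\<omega> t))
        \<le> (\<Sum>\<^sub>\<infinity>i\<in>I. norm (f i * c i t * of_real (\<omega> t)))"
      by (rule norm_infsum_bound[OF s[OF t]])
    moreover have "(\<Sum>\<^sub>\<infinity>i\<in>I. f i * c i t * of_real (\<omega> t)) = (\<Sum>\<^sub>\<infinity>i\<in>I. f i * c i t) * of_real (\<omega> t)"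
      by (rule infsum_cmult_left')
    ultimately show "norm (\<Sum>\<^sub>\<infinity>i\<in>I. f i * c i t) * \<omega> t
        \<le> (\<Sum>\<^sub>\<infinity>i\<in>I. norm (f i * c i t * of_real (\<omega> t)))"
      using weight_ge_1[OF t] by (simp add: norm_mult)
    show "0 \<le> norm (\<Sum>\<^sub>\<infinity>i\<in>I. f i * c i t) * \<omega> t" using weight_ge_1[OF t] by simp
  qed
qed

lemma superposition_integral:
  assumes "\<And>i. i \<in> I \<Longrightarrow> c i \<in> carrier A"
    and "(\<lambda>i. norm (f i :: complex) * wnorm (c i)) summable_on I"
    and "\<And>t. t \<in> carrier G \<Longrightarrow> norm (\<phi> t :: complex) \<le> C"
  shows "(\<Sum>\<^sub>\<infinity>t\<in>carrier G. (\<Sum>\<^sub>\<infinity>i\<in>I. f i * c i t) * \<phi> t)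
       = (\<Sum>\<^sub>\<infinity>i\<in>I. f i * (\<Sum>\<^sub>\<infinity>t\<in>carrier G. c i t * \<phi> t))"
proof -
  have "(\<lambda>(i, t). f i * c i t * \<phi> t) abs_summable_on I \<times> carrier G"
  proof (rule abs_summable_on_comparison_test)
    show "(\<lambda>x. of_real C * (case x of (i, t) \<Rightarrow> f i * c i t * of_real (\<omega> t))) abs_summable_on I \<times> carrier G"
      unfolding norm_mult[of "of_real C"]
      by (rule summable_on_cmult_right[OF superposition_abs_summable[OF assms(1,2)]])
    fix x assume "x \<in> I \<times> carrier G"
    then obtain i t where x: "x = (i, t)" "t \<in> carrier G" by auto
    have "norm (\<phi> t) \<le> \<bar>C\<bar> * 1" using assms(3)[OF x(2)] by linarith
    also have "\<dots> \<le> \<bar>C\<bar> * \<bar>\<omega> t\<bar>"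
      using weight_ge_1[OF x(2)] by (intro mult_left_mono) linarith+
    finally have "norm (f i * c i t) * norm (\<phi> t) \<le> norm (f i * c i t) * (\<bar>C\<bar> * \<bar>\<omega> t\<bar>)"
      by (intro mult_left_mono norm_ge_zero)
    then show "norm (case x of (i, t) \<Rightarrow> f i * c i t * \<phi> t)
        \<le> norm (of_real C * (case x of (i, t) \<Rightarrow> f i * c i t * complex_of_real (\<omega> t)))"
      unfolding x(1) prod.case norm_mult norm_of_real by (simp only: mult_ac)
  qed
  then have "(\<lambda>(i, t). f i * c i t * \<phi> t) summable_on I \<times> carrier G"
    by (rule abs_summable_summable)
  from infsum_swap_banach[OF this]
  have "(\<Sum>\<^sub>\<infinity>i\<in>I. \<Sum>\<^sub>\<infinity>t\<in>carrier G. f i * c i t * \<phi> t)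
      = (\<Sum>\<^sub>\<infinity>t\<in>carrier G. \<Sum>\<^sub>\<infinity>i\<in>I. f i * c i t * \<phi> t)" .
  moreover have "(\<Sum>\<^sub>\<infinity>i\<in>I. \<Sum>\<^sub>\<infinity>t\<in>carrier G. f i * c i t * \<phi> t)
      = (\<Sum>\<^sub>\<infinity>i\<in>I. f i * (\<Sum>\<^sub>\<infinity>t\<in>carrier G. c i t * \<phi> t))"
    by (simp only: mult.assoc infsum_cmult_right')
  moreover have "(\<Sum>\<^sub>\<infinity>t\<in>carrier G. \<Sum>\<^sub>\<infinity>i\<in>I. f i * c i t * \<phi> t)
      = (\<Sum>\<^sub>\<infinity>t\<in>carrier G. (\<Sum>\<^sub>\<infinity>i\<in>I. f i * c i t) * \<phi> t)"
    by (simp only: infsum_cmult_left')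
  ultimately show ?thesis by simp
qed

lemma shift_bij: "g \<in> carrier G \<Longrightarrow> bij_betw (\<lambda>t. g \<otimes> t) (carrier G) (carrier G)"
  by (rule bij_betw_byWitness[where f' = "\<lambda>t. inv g \<otimes> t"]) (auto simp flip: m_assoc)

lemma shift_closed:
  assumes "g \<in> carrier G" "f \<in> carrier A"
  shows "shift g f \<in> carrier A" and "wnorm (shift g f) \<le> \<omega> g * wnorm f"
proof -
  let ?h = "\<lambda>t. norm (shift g f t) * \<omega> t"
  have h: "?h (g \<otimes> t) = norm (f t) * \<omega> (g \<otimes> t)" if "t \<in> carrier G" for t
    using that assms(1) by (simp add: shift_def flip: m_assoc)
  have le: "?h (g \<otimes> t) \<le> \<omega> g * (norm (f t) * \<omega> t)" if "t \<in> carrier G" for t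
    using mult_left_mono[OF weight_mult[OF assms(1) that], of "norm (f t)"]
    unfolding h[OF that] by (simp add: mult_ac)
  have s2: "(\<lambda>t. \<omega> g * (norm (f t) * \<omega> t)) summable_on carrier G"
    using summable_weighted[OF assms(2)] by (rule summable_on_cmult_right)
  have s1: "(\<lambda>t. ?h (g \<otimes> t)) summable_on carrier G"
  proof (rule summable_on_comparison_test[OF s2 le])
    show "0 \<le> ?h (g \<otimes> t)" if "t \<in> carrier G" for t
      using weight_ge_1[of "g \<otimes> t"] assms(1) that by simp
  qed
  then have "?h summable_on carrier G"
    using summable_on_reindex_bij_betw[OF shift_bij[OF assms(1)], of ?h] by simp
  then show "shift g f \<in> carrier A" unfolding carrier_iff by (simp add: shift_def)
  have "wnorm (shift g f) = (\<Sum>\<^sub>\<infinity>t\<in>carrier G. ?h (g \<otimes> t))"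
    unfolding wnorm_def using infsum_reindex_bij_betw[OF shift_bij[OF assms(1)], of ?h] by simp
  also have "\<dots> \<le> (\<Sum>\<^sub>\<infinity>t\<in>carrier G. \<omega> g * (norm (f t) * \<omega> t))"
    by (rule infsum_mono[OF s1 s2 le])
  finally show "wnorm (shift g f) \<le> \<omega> g * wnorm f" by (simp add: wnorm_def infsum_cmult_right')
qed

lemma shift_infsum:
  assumes "g \<in> carrier G"
  shows "(\<Sum>\<^sub>\<infinity>t\<in>carrier G. shift g f t * \<phi> t) = (\<Sum>\<^sub>\<infinity>t\<in>carrier G. f t * \<phi> (g \<otimes> t))"
proof -
  have "(\<Sum>\<^sub>\<infinity>t\<in>carrier G. shift g f t * \<phi> t) = (\<Sum>\<^sub>\<infinity>t\<in>carrier G. shift g f (g \<otimes> t) * \<phi> (g \<otimes> t))"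
    using infsum_reindex_bij_betw[OF shift_bij[OF assms], of "\<lambda>t. shift g f t * \<phi> t"] by simp
  also have "\<dots> = (\<Sum>\<^sub>\<infinity>t\<in>carrier G. f t * \<phi> (g \<otimes> t))"
    using assms by (intro infsum_cong) (simp add: shift_def flip: m_assoc)
  finally show ?thesis .
qed

lemma mult_eq: "a \<otimes>\<^bsub>A\<^esub> f = (\<lambda>t. \<Sum>\<^sub>\<infinity>s\<in>carrier G. a s * shift s f t)"
  unfolding beurling_def shift_def monoid.simps by (rule ext) simp

lemma mult_summable:
  assumes "a \<in> carrier A" "f \<in> carrier A"
  shows "(\<lambda>s. norm (a s) * wnorm (shift s f)) summable_on carrier G"
proof (rule summable_on_comparison_test)
  show "(\<lambda>s. (norm (a s) * \<omega> s) * wnorm f) summable_on carrier G"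
    using summable_weighted[OF assms(1)] by (rule summable_on_cmult_left)
  show "norm (a s) * wnorm (shift s f) \<le> norm (a s) * \<omega> s * wnorm f" if "s \<in> carrier G" for s
    using mult_left_mono[OF shift_closed(2)[OF that assms(2)], of "norm (a s)"]
    by (simp add: mult.assoc)
  show "0 \<le> norm (a s) * wnorm (shift s f)" for s
    by (intro mult_nonneg_nonneg norm_ge_zero wnorm_nonneg)
qed

lemma mult_closed:
  assumes "a \<in> carrier A" "f \<in> carrier A"
  shows "a \<otimes>\<^bsub>A\<^esub> f \<in> carrier A"
  unfolding mult_eq
  by (rule superposition_closed[where c = "\<lambda>s. shift s f", OF _ mult_summable[OF assms]])
    (rule shift_closed(1)[OF _ assms(2)])

text \<open>
  For \<open>\<phi>\<close> pulled back from a finite quotient this yields associativity of the action of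
  the algebra on functions on that quotient.
\<close>
lemma mult_integral:
  assumes "a \<in> carrier A" "f \<in> carrier A" "\<And>t. t \<in> carrier G \<Longrightarrow> norm (\<phi> t :: complex) \<le> C"
  shows "(\<Sum>\<^sub>\<infinity>t\<in>carrier G. (a \<otimes>\<^bsub>A\<^esub> f) t * \<phi> t)
       = (\<Sum>\<^sub>\<infinity>s\<in>carrier G. a s * (\<Sum>\<^sub>\<infinity>t\<in>carrier G. f t * \<phi> (s \<otimes> t)))"
proof -
  have "(\<Sum>\<^sub>\<infinity>t\<in>carrier G. (a \<otimes>\<^bsub>A\<^esub> f) t * \<phi> t)
      = (\<Sum>\<^sub>\<infinity>s\<in>carrier G. a s * (\<Sum>\<^sub>\<infinity>t\<in>carrier G. shift s f t * \<phi> t))"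
    unfolding mult_eq
    by (rule superposition_integral[where c = "\<lambda>s. shift s f",
          OF _ mult_summable[OF assms(1,2)] assms(3)]) (rule shift_closed(1)[OF _ assms(2)])
  also have "\<dots> = (\<Sum>\<^sub>\<infinity>s\<in>carrier G. a s * (\<Sum>\<^sub>\<infinity>t\<in>carrier G. f t * \<phi> (s \<otimes> t)))"
    by (intro infsum_cong) (simp only: shift_infsum)
  finally show ?thesis .
qed

lemma delta_closed: "g \<in> carrier G \<Longrightarrow> delta g \<in> carrier A"
  unfolding carrier_iff
  by (auto simp: delta_def intro!: finite_nonzero_values_imp_summable_on intro: finite_subset[of _ "{g}"])

lemma delta_mult:
  assumes "g \<in> carrier G" shows "delta g \<otimes>\<^bsub>A\<^esub> f = shift g f"
  unfolding mult_eq using assms by (subst infsum_point[of _ g]) (auto simp: delta_def)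

lemma mult_delta:
  assumes "a \<in> carrier A" "h \<in> carrier G"
  shows "a \<otimes>\<^bsub>A\<^esub> delta h = (\<lambda>t. if t \<in> carrier G then a (t \<otimes> inv h) else 0)"
proof (rule ext)
  fix t
  have *: "inv s \<otimes> t = h \<longleftrightarrow> s = t \<otimes> inv h" if "s \<in> carrier G" "t \<in> carrier G" for s
    using that assms(2) by (metis inv_closed inv_solve_left inv_solve_right)
  show "(a \<otimes>\<^bsub>A\<^esub> delta h) t = (if t \<in> carrier G then a (t \<otimes> inv h) else 0)"
    unfolding mult_eq
    by (subst infsum_point[of _ "t \<otimes> inv h"]) (use assms * in \<open>auto simp: shift_def delta_def\<close>)
qed

lemma mult_delta_diff:
  assumes "a \<in> carrier A" "h \<in> carrier G" "k \<in> carrier G"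
  shows "a \<otimes>\<^bsub>A\<^esub> (\<lambda>t. delta h t - delta k t) = (\<lambda>t. (a \<otimes>\<^bsub>A\<^esub> delta h) t - (a \<otimes>\<^bsub>A\<^esub> delta k) t)"
proof (rule ext)
  fix t
  have s: "(\<lambda>s. a s * shift s (delta g) t) summable_on carrier G" for g
    by (rule abs_summable_summable, rule summable_bounded[OF assms(1), of _ 1])
      (auto simp: shift_def delta_def)
  have "(a \<otimes>\<^bsub>A\<^esub> (\<lambda>t. delta h t - delta k t)) t
      = (\<Sum>\<^sub>\<infinity>s\<in>carrier G. a s * shift s (delta h) t + - (a s * shift s (delta k) t))"
    unfolding mult_eq by (intro infsum_cong) (simp add: shift_def algebra_simps)
  also have "\<dots> = (a \<otimes>\<^bsub>A\<^esub> delta h) t - (a \<otimes>\<^bsub>A\<^esub> delta k) t"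
    unfolding mult_eq using s by (subst infsum_add) (simp_all add: infsum_uminus summable_on_uminus)
  finally show "(a \<otimes>\<^bsub>A\<^esub> (\<lambda>t. delta h t - delta k t)) t = (a \<otimes>\<^bsub>A\<^esub> delta h) t - (a \<otimes>\<^bsub>A\<^esub> delta k) t" .
qed

lemma scaled_one_mult:
  assumes "f \<in> carrier A"
  shows "(\<lambda>t. c * delta \<one> t) \<otimes>\<^bsub>A\<^esub> f = (\<lambda>t. c * f t)"
  unfolding mult_eq using assms
  by (subst infsum_point[of _ \<one>]) (auto simp: delta_def shift_def zero_off)

end

section \<open>Left ideals as subspaces\<close>

context weighted_group
begin

lemma module_ops_A:
  "f \<oplus>\<^bsub>A\<^esub> g = f + g" "\<zero>\<^bsub>A\<^esub> = 0" "c \<odot>\<^bsub>A\<^esub> f = (\<lambda>t. c * f t)"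
  by (auto simp: beurling_def)

lemma subspace_carrier: "fn.subspace (carrier A)"
proof (rule fn.subspaceI)
  show "0 \<in> carrier A" unfolding carrier_iff by simp
  show "f + g \<in> carrier A" if "f \<in> carrier A" "g \<in> carrier A" for f g
    unfolding carrier_iff
  proof (intro conjI allI impI)
    show "(f + g) t = 0" if "t \<notin> carrier G" for t
      using that \<open>f \<in> carrier A\<close> \<open>g \<in> carrier A\<close> by (simp add: zero_off)
    show "(\<lambda>t. norm ((f + g) t) * \<omega> t) summable_on carrier G"
    proof (rule summable_on_comparison_test)
      show "(\<lambda>t. norm (f t) * \<omega> t + norm (g t) * \<omega> t) summable_on carrier G"
        using that by (intro summable_on_add summable_weighted)
      fix t assume t: "t \<in> carrier G"
      show "norm ((f + g) t) * \<omega> t \<le> norm (f t) * \<omega> t + norm (g t) * \<omega> t"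
        using mult_right_mono[OF norm_triangle_ineq[of "f t" "g t"], of "\<omega> t"] weight_ge_1[OF t]
        by (simp add: distrib_right)
      show "0 \<le> norm ((f + g) t) * \<omega> t" using weight_ge_1[OF t] by simp
    qed
  qed
  show "(\<lambda>t. c * f t) \<in> carrier A" if "f \<in> carrier A" for c f
    using that summable_on_cmult_right[OF summable_weighted[OF that], of "norm c"]
    unfolding carrier_iff by (simp add: norm_mult mult.assoc)
qed

lemma abelian_group_A: "abelian_group A"
proof (rule abelian_groupI)
  show "\<exists>y\<in>carrier A. y \<oplus>\<^bsub>A\<^esub> x = \<zero>\<^bsub>A\<^esub>" if "x \<in> carrier A" for x
    using fn.subspace_neg[OF subspace_carrier that]
    by (intro bexI[of _ "- x"]) (simp_all add: module_ops_A)
qed (use fn.subspace_add[OF subspace_carrier] fn.subspace_0[OF subspace_carrier]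
    in \<open>auto simp: module_ops_A add_ac\<close>)

lemma finsum_A:
  assumes "finite B" "F \<in> B \<rightarrow> carrier A"
  shows "finsum A F B = (\<Sum>b\<in>B. F b)"
proof -
  interpret abelian_group A by (rule abelian_group_A)
  show ?thesis using assms
    by (induction B rule: finite_induct) (auto simp: module_ops_A)
qed

text \<open>
  Replaces the carrier-based notion by subspaces of a function space, so that dimension arguments apply.
\<close>
lemma left_ideal_iff:
  "left_ideal A I \<longleftrightarrow>
    fn.subspace I \<and> I \<subseteq> carrier A \<and> (\<forall>a \<in> carrier A. \<forall>x \<in> I. a \<otimes>\<^bsub>A\<^esub> x \<in> I)"
proof -
  interpret abelian_group A by (rule abelian_group_A)
  have neg: "\<ominus>\<^bsub>A\<^esub> x = - x" if "x \<in> carrier A" for x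
    using that fn.subspace_neg[OF subspace_carrier that]
    by (intro minus_equality) (simp_all add: module_ops_A)
  have "additive_subgroup I A" if "fn.subspace I" "I \<subseteq> carrier A"
    unfolding additive_subgroup_def
  proof (rule group.subgroupI[OF a_group])
    show "I \<noteq> {}" using fn.subspace_0[OF that(1)] by auto
    fix x y assume xy: "x \<in> I" "y \<in> I"
    have "inv\<^bsub>add_monoid A\<^esub> x = - x" using neg[of x] xy that by (auto simp only: a_inv_def)
    then show "inv\<^bsub>add_monoid A\<^esub> x \<in> I" using fn.subspace_neg[OF that(1) xy(1)] by simp
    show "x \<otimes>\<^bsub>add_monoid A\<^esub> y \<in> I"
      using fn.subspace_add[OF that(1) xy] by (simp add: module_ops_A)
  qed (use that in auto)
  moreover have "fn.subspace I" "I \<subseteq> carrier A"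
    if "additive_subgroup I A" "\<forall>c. \<forall>x\<in>I. c \<odot>\<^bsub>A\<^esub> x \<in> I"
    using that additive_subgroup.zero_closed[OF that(1)] additive_subgroup.a_closed[OF that(1)]
      additive_subgroup.a_subset[OF that(1)]
    by (auto simp: module_ops_A intro!: fn.subspaceI)
  moreover have "c \<odot>\<^bsub>A\<^esub> x \<in> I" if "fn.subspace I" "x \<in> I" for c x
    using fn.subspace_scale[OF that] by (simp add: module_ops_A)
  ultimately show ?thesis unfolding left_ideal_def by blast
qed

lemma finite_codimI:
  assumes "finite K" "\<And>x. x \<in> K \<Longrightarrow> e x \<in> carrier A" "inj_on e K"
    and "\<And>a. a \<in> carrier A \<Longrightarrow> a - (\<Sum>x\<in>K. (\<lambda>t. k a x * e x t)) \<in> I"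
  shows "finite_codim A I"
  unfolding finite_codim_def
proof (intro exI[of _ "e ` K"] conjI ballI)
  fix a assume a: "a \<in> carrier A"
  define c where "c b = k a (the_inv_into K e b)" for b
  have "(\<Oplus>\<^bsub>A\<^esub>b\<in>e ` K. c b \<odot>\<^bsub>A\<^esub> b) = (\<Sum>b\<in>e ` K. (\<lambda>t. c b * b t))"
    using assms fn.subspace_scale[OF subspace_carrier]
    by (subst finsum_A) (auto simp: module_ops_A)
  also have "\<dots> = (\<Sum>x\<in>K. (\<lambda>t. k a x * e x t))"
    using assms(3) by (subst sum.reindex) (auto simp: c_def the_inv_into_f_f intro!: sum.cong)
  finally show "\<exists>c. \<exists>y\<in>I. a = y \<oplus>\<^bsub>A\<^esub> (\<Oplus>\<^bsub>A\<^esub>b\<in>e ` K. c b \<odot>\<^bsub>A\<^esub> b)"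
    using assms(4)[OF a] by (intro exI[of _ c] bexI[of _ "a - (\<Sum>x\<in>K. (\<lambda>t. k a x * e x t))"])
      (simp_all add: module_ops_A)
qed (use assms in auto)

lemma mult_one: "a \<in> carrier A \<Longrightarrow> a \<otimes>\<^bsub>A\<^esub> delta \<one> = a"
  by (auto simp: mult_delta fun_eq_iff zero_off)

end

section \<open>Simple modules from finite quotients\<close>

text \<open>
  Functions on the finite group \<open>Q\<close> form a left module over the algebra: an element \<open>a\<close> acts by
  summing right translates with weights \<open>a s\<close>. Right translation (rather than left) makes this a left
  action without inverses.
\<close>
locale finite_quotient = weighted_group G \<omega> + Q: group Q
  for G :: "('a, 'b) monoid_scheme" (structure) and \<omega> and Q :: "('q, 'r) monoid_scheme" +
  fixes p :: "'a \<Rightarrow> 'q"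
  assumes p_hom: "p \<in> hom G Q"
    and p_surj: "p ` carrier G = carrier Q"
    and finite_Q: "finite (carrier Q)"
begin

lemma p_closed: "g \<in> carrier G \<Longrightarrow> p g \<in> carrier Q"
  using p_surj by auto

lemma p_mult: "g \<in> carrier G \<Longrightarrow> h \<in> carrier G \<Longrightarrow> p (g \<otimes> h) = p g \<otimes>\<^bsub>Q\<^esub> p h"
  using p_hom by (rule hom_mult)

lemma p_one: "p \<one> = \<one>\<^bsub>Q\<^esub>"
  using p_hom hom_one is_group Q.is_group by blast

text \<open>
  The image of \<open>a\<close> in the group algebra of \<open>Q\<close>. Multiplying by a 0-1 function instead of restricting
  the domain lets the summability lemmas for bounded functions apply.
\<close>
definition fibre :: "('a \<Rightarrow> complex) \<Rightarrow> 'q \<Rightarrow> complex" where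
  "fibre a x = (\<Sum>\<^sub>\<infinity>s\<in>carrier G. a s * (if p s = x then 1 else 0))"

definition QFun :: "('q \<Rightarrow> complex) set" where
  "QFun = {w. \<forall>q. q \<notin> carrier Q \<longrightarrow> w q = 0}"

definition rtrans :: "'q \<Rightarrow> ('q \<Rightarrow> complex) \<Rightarrow> 'q \<Rightarrow> complex" where
  "rtrans x w = (\<lambda>q. if q \<in> carrier Q then w (q \<otimes>\<^bsub>Q\<^esub> x) else 0)"

definition act :: "('a \<Rightarrow> complex) \<Rightarrow> ('q \<Rightarrow> complex) \<Rightarrow> 'q \<Rightarrow> complex" where
  "act a w = (\<lambda>q. if q \<in> carrier Q then \<Sum>\<^sub>\<infinity>s\<in>carrier G. a s * w (q \<otimes>\<^bsub>Q\<^esub> p s) else 0)"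

definition submod :: "('q \<Rightarrow> complex) set \<Rightarrow> bool" where
  "submod W \<longleftrightarrow> fn.subspace W \<and> W \<subseteq> QFun \<and> (\<forall>x \<in> carrier Q. \<forall>w \<in> W. rtrans x w \<in> W)"

definition simple_submod :: "('q \<Rightarrow> complex) set \<Rightarrow> bool" where
  "simple_submod W \<longleftrightarrow> submod W \<and> W \<noteq> {0} \<and> (\<forall>V. submod V \<and> V \<subseteq> W \<longrightarrow> V = {0} \<or> V = W)"

lemma norm_le_sum:
  fixes w :: "'q \<Rightarrow> complex"
  assumes "q \<in> carrier Q" shows "norm (w q) \<le> (\<Sum>x\<in>carrier Q. norm (w x))"
  using assms finite_Q by (intro member_le_sum) auto

lemma act_summable:
  assumes "a \<in> carrier A" "q \<in> carrier Q"
  shows "(\<lambda>s. a s * w (q \<otimes>\<^bsub>Q\<^esub> p s)) summable_on carrier G"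
  by (rule abs_summable_summable, rule summable_bounded[OF assms(1)], rule norm_le_sum)
    (use assms p_closed in simp)

lemma fibre_summable:
  assumes "a \<in> carrier A"
  shows "(\<lambda>s. a s * (if p s = x then 1 else 0)) summable_on carrier G"
  by (rule abs_summable_summable, rule summable_bounded[OF assms, of _ 1]) simp

text \<open>
  The action factors through the group algebra of \<open>Q\<close>; in particular every submodule closed under the
  translates \<open>rtrans x\<close> is closed under the whole algebra.
\<close>
lemma act_fibre:
  assumes "a \<in> carrier A"
  shows "act a w = (\<Sum>x\<in>carrier Q. (\<lambda>q. fibre a x * rtrans x w q))"
proof (rule ext)
  fix q
  have "act a w q = (\<Sum>x\<in>carrier Q. fibre a x * w (q \<otimes>\<^bsub>Q\<^esub> x))" if q: "q \<in> carrier Q"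
  proof -
    have "act a w q
        = (\<Sum>\<^sub>\<infinity>s\<in>carrier G. \<Sum>x\<in>carrier Q. (a s * (if p s = x then 1 else 0)) * w (q \<otimes>\<^bsub>Q\<^esub> x))"
      unfolding act_def using q
    proof (simp, intro infsum_cong)
      fix s assume "s \<in> carrier G"
      have "(\<Sum>x\<in>carrier Q. (a s * (if p s = x then 1 else 0)) * w (q \<otimes>\<^bsub>Q\<^esub> x))
          = (\<Sum>x\<in>carrier Q. if p s = x then a s * w (q \<otimes>\<^bsub>Q\<^esub> x) else 0)"
        by (intro sum.cong) auto
      then show "a s * w (q \<otimes>\<^bsub>Q\<^esub> p s)
          = (\<Sum>x\<in>carrier Q. a s * (if p s = x then 1 else 0) * w (q \<otimes>\<^bsub>Q\<^esub> x))"
        using p_closed[OF \<open>s \<in> carrier G\<close>] finite_Q by simp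
    qed
    also have "\<dots> = (\<Sum>x\<in>carrier Q.
        \<Sum>\<^sub>\<infinity>s\<in>carrier G. (a s * (if p s = x then 1 else 0)) * w (q \<otimes>\<^bsub>Q\<^esub> x))"
      by (rule summable_on_sum(2)[OF finite_Q summable_on_cmult_left[OF fibre_summable[OF assms]]])
    also have "\<dots> = (\<Sum>x\<in>carrier Q. fibre a x * w (q \<otimes>\<^bsub>Q\<^esub> x))"
      unfolding fibre_def by (simp only: infsum_cmult_left')
    finally show ?thesis .
  qed
  then show "act a w q = (\<Sum>x\<in>carrier Q. (\<lambda>q. fibre a x * rtrans x w q)) q"
    by (simp add: sum_fun_apply rtrans_def) (simp add: act_def)
qed

lemma act_mult:
  assumes "a \<in> carrier A" "f \<in> carrier A"
  shows "act (a \<otimes>\<^bsub>A\<^esub> f) w = act a (act f w)"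
proof (rule ext)
  fix q
  show "act (a \<otimes>\<^bsub>A\<^esub> f) w q = act a (act f w) q"
  proof (cases "q \<in> carrier Q")
    case True
    have "act (a \<otimes>\<^bsub>A\<^esub> f) w q = (\<Sum>\<^sub>\<infinity>t\<in>carrier G. (a \<otimes>\<^bsub>A\<^esub> f) t * w (q \<otimes>\<^bsub>Q\<^esub> p t))"
      using True by (simp add: act_def)
    also have "\<dots> = (\<Sum>\<^sub>\<infinity>s\<in>carrier G. a s * (\<Sum>\<^sub>\<infinity>t\<in>carrier G. f t * w (q \<otimes>\<^bsub>Q\<^esub> p (s \<otimes> t))))"
      by (rule mult_integral[OF assms], rule norm_le_sum) (use True p_closed in simp)
    also have "\<dots> = (\<Sum>\<^sub>\<infinity>s\<in>carrier G. a s * act f w (q \<otimes>\<^bsub>Q\<^esub> p s))"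
    proof (rule infsum_cong)
      fix s assume s: "s \<in> carrier G"
      have "(\<Sum>\<^sub>\<infinity>t\<in>carrier G. f t * w (q \<otimes>\<^bsub>Q\<^esub> p (s \<otimes> t))) = act f w (q \<otimes>\<^bsub>Q\<^esub> p s)"
        unfolding act_def using True s p_closed
        by (auto simp: p_mult Q.m_assoc intro!: infsum_cong)
      then show "a s * (\<Sum>\<^sub>\<infinity>t\<in>carrier G. f t * w (q \<otimes>\<^bsub>Q\<^esub> p (s \<otimes> t))) = a s * act f w (q \<otimes>\<^bsub>Q\<^esub> p s)"
        by simp
    qed
    finally show ?thesis using True by (simp add: act_def)
  qed (simp add: act_def)
qed

lemma act_add:
  assumes "a \<in> carrier A" "b \<in> carrier A"
  shows "act (a + b) w = act a w + act b w"
proof (rule ext)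
  fix q show "act (a + b) w q = (act a w + act b w) q"
    using infsum_add[OF act_summable[OF assms(1)] act_summable[OF assms(2)], of q q w w]
    by (cases "q \<in> carrier Q") (auto simp: act_def distrib_right)
qed

lemma act_scale: "act (\<lambda>t. c * a t) w = (\<lambda>q. c * act a w q)"
  by (auto simp: act_def mult.assoc infsum_cmult_right')

lemma act_diff:
  assumes "a \<in> carrier A" "b \<in> carrier A"
  shows "act (a - b) w = act a w - act b w"
proof -
  have "(a - b) + b = a" by simp
  then show ?thesis
    using act_add[OF fn.subspace_diff[OF subspace_carrier assms] assms(2), of w] by (simp add: eq_diff_eq)
qed

lemma act_zero: "act 0 w = 0" "act a 0 = 0"
  by (auto simp: act_def fun_eq_iff)

lemma act_sum:
  assumes "finite K" "\<And>x. x \<in> K \<Longrightarrow> e x \<in> carrier A"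
  shows "act (\<Sum>x\<in>K. (\<lambda>t. k x * e x t)) w = (\<Sum>x\<in>K. (\<lambda>q. k x * act (e x) w q))"
  using assms
proof (induction K rule: finite_induct)
  case (insert x K)
  have "(\<Sum>x\<in>K. (\<lambda>t. k x * e x t)) \<in> carrier A" "(\<lambda>t. k x * e x t) \<in> carrier A"
    using insert.prems fn.subspace_scale[OF subspace_carrier]
    by (auto intro!: fn.subspace_sum[OF subspace_carrier])
  then show ?case
    unfolding sum.insert[OF insert.hyps] using insert by (simp only: act_add act_scale insert_iff simp_thms)
qed (simp add: act_zero)

lemma act_delta:
  assumes "g \<in> carrier G" shows "act (delta g) w = rtrans (p g) w"
  unfolding act_def rtrans_def
  by (rule ext, subst infsum_point[of _ g]) (use assms in \<open>auto simp: delta_def\<close>)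

lemma rtrans_one: "w \<in> QFun \<Longrightarrow> rtrans \<one>\<^bsub>Q\<^esub> w = w"
  by (auto simp: rtrans_def QFun_def fun_eq_iff)

lemma submod_act:
  assumes "submod W" "a \<in> carrier A" "w \<in> W"
  shows "act a w \<in> W"
  unfolding act_fibre[OF assms(2)]
  using assms unfolding submod_def
  by (intro fn.subspace_sum fn.subspace_scale) auto

text \<open>
  A left ideal \<open>J\<close> containing \<open>M\<close> maps \<open>w0\<close> onto a submodule of the simple module \<open>W\<close>. If this is zero,
  then \<open>J = M\<close>. If it is \<open>W\<close>, some \<open>j\<close> in \<open>J\<close> fixes \<open>w0\<close>, so \<open>1 - j\<close> is in \<open>M\<close> and \<open>1\<close> is in \<open>J\<close>.
  For the codimension, the element \<open>a\<close> and the finite combination of point masses with coefficients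
  \<open>fibre a x\<close> act on \<open>w0\<close> in the same way.
\<close>
lemma annihilator_maximal:
  assumes W: "simple_submod W" and w0: "w0 \<in> W" "w0 \<noteq> 0"
  defines "M \<equiv> {a \<in> carrier A. act a w0 = 0}"
  shows "maximal_left_ideal A M" "finite_codim A M"
proof -
  have sW: "submod W" and Q0: "w0 \<in> QFun" using W w0 by (auto simp: simple_submod_def submod_def)
  have sub: "fn.subspace M"
    unfolding M_def
    by (rule fn.subspaceI)
      (use fn.subspace_0[OF subspace_carrier] fn.subspace_add[OF subspace_carrier]
        fn.subspace_scale[OF subspace_carrier] in \<open>auto simp: act_add act_scale act_zero fun_eq_iff\<close>)
  have M: "left_ideal A M"
    unfolding left_ideal_iff using sub mult_closed by (auto simp: M_def act_mult act_zero)
  have d1: "delta \<one> \<in> carrier A" "act (delta \<one>) w0 = w0"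
    using Q0 by (simp_all add: delta_closed act_delta p_one rtrans_one)
  have max: "J = M \<or> J = carrier A" if J: "left_ideal A J" "M \<subseteq> J" for J
  proof (rule disjCI)
    assume "J \<noteq> carrier A"
    have Js: "fn.subspace J" and Jc: "J \<subseteq> carrier A"
      and Jm: "\<And>a x. a \<in> carrier A \<Longrightarrow> x \<in> J \<Longrightarrow> a \<otimes>\<^bsub>A\<^esub> x \<in> J"
      using J(1) unfolding left_ideal_iff by auto
    define V where "V = (\<lambda>a. act a w0) ` J"
    have "submod V" unfolding submod_def
    proof (intro conjI ballI)
      show "fn.subspace V"
      proof (rule fn.subspaceI)
        show "0 \<in> V" unfolding V_def using fn.subspace_0[OF Js] act_zero(1) by (metis image_eqI)
      next
        fix u v assume "u \<in> V" "v \<in> V"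
        then obtain a b where "a \<in> J" "b \<in> J" "u = act a w0" "v = act b w0" unfolding V_def by auto
        then show "u + v \<in> V" unfolding V_def using Jc act_add[of a b w0] fn.subspace_add[OF Js, of a b]
          by (metis image_eqI subsetD)
      next
        fix c v assume "v \<in> V"
        then obtain a where "a \<in> J" "v = act a w0" unfolding V_def by auto
        then show "(\<lambda>t. c * v t) \<in> V" unfolding V_def using act_scale[of c a w0] fn.subspace_scale[OF Js, of a c]
          by (metis image_eqI)
      qed
      show "V \<subseteq> QFun" by (auto simp: V_def act_def QFun_def)
      fix x v assume "x \<in> carrier Q" "v \<in> V"
      then obtain a where "a \<in> J" "v = act a w0" unfolding V_def by blast
      moreover obtain g where "g \<in> carrier G" "x = p g"
        using \<open>x \<in> carrier Q\<close> p_surj by blast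
      ultimately have ag: "a \<in> J" "v = act a w0" "g \<in> carrier G" "x = p g" by blast+
      have "rtrans x v = act (delta g \<otimes>\<^bsub>A\<^esub> a) w0"
        using ag Jc by (simp add: act_delta act_mult delta_closed subset_iff)
      then show "rtrans x v \<in> V" unfolding V_def using Jm[OF delta_closed[OF ag(3)] ag(1)] by simp
    qed
    moreover have "V \<subseteq> W" using submod_act[OF sW _ w0(1)] Jc by (auto simp: V_def)
    ultimately have "V = {0} \<or> V = W" using W by (auto simp: simple_submod_def)
    then show "J = M"
    proof
      assume "V = {0}"
      then have "J \<subseteq> M" using Jc unfolding M_def V_def by auto
      then show ?thesis using J by auto
    next
      assume "V = W"
      then obtain j where j: "j \<in> J" "act j w0 = w0" using w0 unfolding V_def by force
      have "delta \<one> - j \<in> M" unfolding M_def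
        using j Jc d1 fn.subspace_diff[OF subspace_carrier d1(1), of j] by (auto simp: act_diff)
      then have "delta \<one> - j + j \<in> J" using J j fn.subspace_add[OF Js] by blast
      then have "delta \<one> \<in> J" by simp
      then have "carrier A \<subseteq> J" using Jm mult_one by (metis subsetI)
      then show ?thesis using Jc \<open>J \<noteq> carrier A\<close> by auto
    qed
  qed
  have "delta \<one> \<notin> M" unfolding M_def using d1(2) w0(2) by simp
  then have "M \<noteq> carrier A" using d1(1) by blast
  then show "maximal_left_ideal A M"
    unfolding maximal_left_ideal_def by (intro conjI allI impI M max) auto

  have "\<forall>x\<in>carrier Q. \<exists>s. s \<in> carrier G \<and> p s = x" using p_surj by (auto simp flip: p_surj)
  from bchoice[OF this] obtain g where g: "\<And>x. x \<in> carrier Q \<Longrightarrow> g x \<in> carrier G \<and> p (g x) = x"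
    by blast
  show "finite_codim A M"
  proof (rule finite_codimI[OF finite_Q, of "\<lambda>x. delta (g x)" fibre])
    show "delta (g x) \<in> carrier A" if "x \<in> carrier Q" for x
      using g[OF that] by (simp add: delta_closed)
    show "inj_on (\<lambda>x. delta (g x)) (carrier Q)"
    proof (rule inj_onI)
      fix x y assume xy: "x \<in> carrier Q" "y \<in> carrier Q" "delta (g x) = delta (g y)"
      have "g x = g y" using fun_cong[OF xy(3), of "g x"] by (simp add: delta_def split: if_splits)
      then have "p (g x) = p (g y)" by (rule arg_cong)
      then show "x = y" unfolding conjunct2[OF g[OF xy(1)]] conjunct2[OF g[OF xy(2)]] .
    qed
    fix a assume a: "a \<in> carrier A"
    let ?s = "\<Sum>x\<in>carrier Q. (\<lambda>t. fibre a x * delta (g x) t)"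
    have s: "?s \<in> carrier A"
      using g fn.subspace_scale[OF subspace_carrier] by (intro fn.subspace_sum[OF subspace_carrier]) (auto simp: delta_closed)
    have "act ?s w0 = (\<Sum>x\<in>carrier Q. (\<lambda>q. fibre a x * act (delta (g x)) w0 q))"
      using g by (intro act_sum finite_Q) (auto simp: delta_closed)
    also have "\<dots> = act a w0"
      unfolding act_fibre[OF a] using g by (intro sum.cong) (auto simp: act_delta)
    finally show "a - ?s \<in> M"
      unfolding M_def using fn.subspace_diff[OF subspace_carrier a s] by (simp add: act_diff[OF a s])
  qed
qed

lemma QFun_finite_dim: "QFun \<subseteq> fn.span ((\<lambda>x q. if q = x then 1 else 0) ` carrier Q)"
proof
  fix w assume w: "w \<in> QFun"
  have "w = (\<Sum>x\<in>carrier Q. (\<lambda>q. w x * (if q = x then 1 else 0)))"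
    using w finite_Q by (auto simp: fun_eq_iff sum_fun_apply QFun_def if_distrib cong: if_cong)
  also have "\<dots> \<in> fn.span ((\<lambda>x q. if q = x then 1 else 0) ` carrier Q)"
    by (intro fn.span_sum fn.span_scale fn.span_base) auto
  finally show "w \<in> fn.span ((\<lambda>x q. if q = x then 1 else 0) ` carrier Q)" .
qed

lemma simple_submod_exists:
  assumes "submod U" "U \<noteq> {0}"
  obtains W where "simple_submod W" "W \<subseteq> U"
proof -
  let ?P = "\<lambda>V. submod V \<and> V \<subseteq> U \<and> V \<noteq> {0}"
  obtain W where W: "?P W" and min: "\<And>V. ?P V \<Longrightarrow> fn.dim W \<le> fn.dim V"
    using ex_has_least_nat[of ?P U fn.dim] assms by blast
  have "V = W" if V: "submod V" "V \<subseteq> W" "V \<noteq> {0}" for V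
  proof (rule ccontr)
    assume "V \<noteq> W"
    then have "fn.dim V < fn.dim W"
      using V W QFun_finite_dim finite_Q
      by (intro fn.dim_subspace_less[of _ _ "(\<lambda>x q. if q = x then 1 else 0) ` carrier Q"])
        (auto simp: submod_def)
    then show False using min[of V] V W by auto
  qed
  then have "simple_submod W" using W unfolding simple_submod_def by blast
  then show ?thesis using W that by blast
qed

lemma rtrans_add: "rtrans x (v + w) = rtrans x v + rtrans x w"
  and rtrans_scale: "rtrans x (\<lambda>q. c * w q) = (\<lambda>q. c * rtrans x w q)"
  and rtrans_zero: "rtrans x 0 = 0"
  by (auto simp: rtrans_def fun_eq_iff)

lemma rtrans_rtrans:
  assumes "x \<in> carrier Q" "y \<in> carrier Q"
  shows "rtrans x (rtrans y w) = rtrans (x \<otimes>\<^bsub>Q\<^esub> y) w"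
  using assms by (auto simp: rtrans_def fun_eq_iff Q.m_assoc)

lemma submod_span_translates: "submod (fn.span ((\<lambda>x. rtrans x u) ` carrier Q))"
proof -
  let ?T = "(\<lambda>x. rtrans x u) ` carrier Q"
  have QF: "fn.subspace QFun" by (auto simp: QFun_def intro!: fn.subspaceI)
  have "fn.span ?T \<subseteq> QFun"
    by (rule fn.span_minimal[OF _ QF]) (auto simp: rtrans_def QFun_def)
  moreover have "rtrans x v \<in> fn.span ?T" if x: "x \<in> carrier Q" and "v \<in> fn.span ?T" for x v
    using that(2)
  proof (induction rule: fn.span_induct_alt)
    case base show ?case unfolding rtrans_zero by (rule fn.span_zero)
  next
    case (step c b v)
    then obtain y where "y \<in> carrier Q" "b = rtrans y u" by auto
    then have "rtrans x b \<in> fn.span ?T"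
      using x by (auto simp: rtrans_rtrans intro!: fn.span_base)
    then show ?case unfolding rtrans_add rtrans_scale
      using step by (intro fn.span_add fn.span_scale)
  qed
  ultimately show ?thesis unfolding submod_def by auto
qed

text \<open>
  This is where semisimplicity of the complex group algebra of \<open>Q\<close> enters. Suppose that \<open>f\<close> kills a simple
  submodule \<open>W\<close>. Evaluating \<open>f\<close> acting on translates of \<open>w\<close> in \<open>W\<close> at the identity gives the inner
  products of \<open>w\<close> with the translates of the conjugate \<open>u\<close> of \<open>fibre f\<close>. So \<open>W\<close> is orthogonal
  to the submodule generated by \<open>u\<close>, and choosing \<open>W\<close> inside that submodule gives a contradiction.
\<close>
lemma separating_simple_submod:
  assumes f: "f \<in> carrier A" and x0: "x0 \<in> carrier Q" "fibre f x0 \<noteq> 0"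
  obtains W w0 where "simple_submod W" "w0 \<in> W" "act f w0 \<noteq> 0"
proof -
  define u where "u = (\<lambda>q. if q \<in> carrier Q then cnj (fibre f q) else 0)"
  define U where "U = fn.span ((\<lambda>x. rtrans x u) ` carrier Q)"
  have "u \<in> QFun" by (auto simp: u_def QFun_def)
  then have "rtrans \<one>\<^bsub>Q\<^esub> u = u" by (rule rtrans_one)
  then have "u \<in> U" unfolding U_def by (metis Q.one_closed fn.span_base imageI)
  moreover have "u x0 \<noteq> 0" using x0 by (simp add: u_def)
  ultimately have "U \<noteq> {0}" by force
  then obtain W where W: "simple_submod W" "W \<subseteq> U"
    using simple_submod_exists[of U] submod_span_translates U_def by metis
  have sW: "submod W" using W by (simp add: simple_submod_def)
  have "\<exists>w0\<in>W. act f w0 \<noteq> 0"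
  proof (rule ccontr)
    assume "\<not> ?thesis"
    then have kill: "act f w = 0" if "w \<in> W" for w using that by blast
    have orth: "(\<Sum>q\<in>carrier Q. w q * cnj (v q)) = 0" if w: "w \<in> W" and "v \<in> U" for v w
      using that(2) unfolding U_def
    proof (induction rule: fn.span_induct_alt)
      case (step c b v)
      then obtain x where x: "x \<in> carrier Q" "b = rtrans x u" by auto
      have ix: "inv\<^bsub>Q\<^esub> x \<in> carrier Q" using x by simp
      have bij: "bij_betw (\<lambda>q. q \<otimes>\<^bsub>Q\<^esub> x) (carrier Q) (carrier Q)"
        by (rule bij_betw_byWitness[where f' = "\<lambda>q. q \<otimes>\<^bsub>Q\<^esub> inv\<^bsub>Q\<^esub> x"]) (use x in \<open>auto simp: Q.m_assoc\<close>)
      \<comment> \<open>Substituting \<open>y = q x\<close> turns the inner product into \<open>f\<close> acting on a translate of \<open>w\<close>.\<close>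
      have "(\<Sum>q\<in>carrier Q. w q * cnj (b q)) = (\<Sum>q\<in>carrier Q. w q * fibre f (q \<otimes>\<^bsub>Q\<^esub> x))"
        using x by (intro sum.cong) (auto simp: rtrans_def u_def)
      also have "\<dots> = (\<Sum>q\<in>carrier Q. fibre f (q \<otimes>\<^bsub>Q\<^esub> x) * w ((q \<otimes>\<^bsub>Q\<^esub> x) \<otimes>\<^bsub>Q\<^esub> inv\<^bsub>Q\<^esub> x))"
        using x by (intro sum.cong) (auto simp: Q.m_assoc)
      also have "\<dots> = (\<Sum>y\<in>carrier Q. fibre f y * w (y \<otimes>\<^bsub>Q\<^esub> inv\<^bsub>Q\<^esub> x))"
        by (rule sum.reindex_bij_betw[OF bij])
      also have "\<dots> = (\<Sum>y\<in>carrier Q. fibre f y * rtrans y (rtrans (inv\<^bsub>Q\<^esub> x) w) \<one>\<^bsub>Q\<^esub>)"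
        using x by (intro sum.cong) (auto simp: rtrans_def)
      also have "\<dots> = act f (rtrans (inv\<^bsub>Q\<^esub> x) w) \<one>\<^bsub>Q\<^esub>"
        by (simp add: act_fibre[OF f] sum_fun_apply)
      also have "\<dots> = 0" using kill[of "rtrans (inv\<^bsub>Q\<^esub> x) w"] sW ix w unfolding submod_def by auto
      finally have b0: "(\<Sum>q\<in>carrier Q. w q * cnj (b q)) = 0" .
      have "(\<Sum>q\<in>carrier Q. w q * cnj (((\<lambda>t. c * b t) + v) q))
          = cnj c * (\<Sum>q\<in>carrier Q. w q * cnj (b q)) + (\<Sum>q\<in>carrier Q. w q * cnj (v q))"
        by (simp add: sum_distrib_left sum.distrib algebra_simps)
      then show ?case using b0 step by simp
    qed simp
    have "w = 0" if w: "w \<in> W" for w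
    proof -
      have "(\<Sum>q\<in>carrier Q. w q * cnj (w q)) = 0" using orth[OF w] w W by auto
      then have "complex_of_real (\<Sum>q\<in>carrier Q. (norm (w q))\<^sup>2) = 0"
        by (simp only: of_real_sum complex_norm_square)
      then have "(\<Sum>q\<in>carrier Q. (norm (w q))\<^sup>2) = 0" by (simp only: of_real_eq_0_iff)
      then have "\<forall>q\<in>carrier Q. w q = 0" using finite_Q by (simp add: sum_nonneg_eq_0_iff)
      then show ?thesis using w sW unfolding submod_def QFun_def by (auto simp: fun_eq_iff)
    qed
    moreover have "0 \<in> W" using sW fn.subspace_0 unfolding submod_def by blast
    ultimately show False using W unfolding simple_submod_def by blast
  qed
  then show ?thesis using that W by blast
qed

lemma separating_maximal_left_ideal:
  assumes "f \<in> carrier A" "x0 \<in> carrier Q" "fibre f x0 \<noteq> 0"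
  obtains M where "maximal_left_ideal A M" "finite_codim A M" "f \<notin> M"
proof -
  obtain W w0 where W: "simple_submod W" "w0 \<in> W" "act f w0 \<noteq> 0"
    using separating_simple_submod[OF assms] by blast
  have "w0 \<noteq> 0" using W(3) act_zero(2) by auto
  then show ?thesis using annihilator_maximal[OF W(1,2)] W(3) that by blast
qed

end

section \<open>Residual finiteness separates points\<close>

lemma (in group) finite_quotient_Int:
  assumes "N \<lhd> G" "M \<lhd> G" "finite (carrier (G Mod N))" "finite (carrier (G Mod M))"
  shows "N \<inter> M \<lhd> G" "finite (carrier (G Mod (N \<inter> M)))"
proof -
  interpret N: normal N G by fact
  interpret M: normal M G by fact
  show "N \<inter> M \<lhd> G" by (rule normal_subgroup_intersect[OF assms(1,2)])
  have *: "(N \<inter> M) #> t = (N #> t) \<inter> (M #> t)" if "t \<in> carrier G" for t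
    using that N.subset M.subset by (fastforce simp: r_coset_def)
  have "carrier (G Mod (N \<inter> M)) \<subseteq> (\<lambda>(x, y). x \<inter> y) ` (carrier (G Mod N) \<times> carrier (G Mod M))"
  proof
    fix x assume "x \<in> carrier (G Mod (N \<inter> M))"
    then obtain t where "t \<in> carrier G" "x = (N \<inter> M) #> t"
      by (auto simp: FactGroup_def RCOSETS_def)
    then show "x \<in> (\<lambda>(x, y). x \<inter> y) ` (carrier (G Mod N) \<times> carrier (G Mod M))"
      by (intro image_eqI[of _ _ "(N #> t, M #> t)"]) (auto simp: * FactGroup_def RCOSETS_def)
  qed
  then show "finite (carrier (G Mod (N \<inter> M)))"
    by (rule finite_subset) (use assms in auto)
qed

lemma (in group) finite_quotient_carrier:
  "carrier G \<lhd> G" "finite (carrier (G Mod carrier G))"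
proof -
  show "carrier G \<lhd> G" by (rule normal_invI[OF subgroup_self]) auto
  have "carrier (G Mod carrier G) \<subseteq> {carrier G}"
    using coset_join2[OF _ subgroup_self] by (auto simp: FactGroup_def RCOSETS_def)
  then show "finite (carrier (G Mod carrier G))" by (rule finite_subset) simp
qed

lemma (in group) residually_finite_avoid_finite:
  assumes "residually_finite G" "finite F" "F \<subseteq> carrier G - {\<one>}"
  obtains N where "N \<lhd> G" "finite (carrier (G Mod N))" "N \<inter> F = {}"
proof -
  have "\<exists>N. N \<lhd> G \<and> finite (carrier (G Mod N)) \<and> N \<inter> F = {}"
    using assms(2,3)
  proof (induction F rule: finite_induct)
    case empty
    then show ?case using finite_quotient_carrier by blast
  next
    case (insert g F)
    then obtain N where N: "N \<lhd> G" "finite (carrier (G Mod N))" "N \<inter> F = {}" by auto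
    obtain M where M: "M \<lhd> G" "finite (carrier (G Mod M))" "g \<notin> M"
      using assms(1) insert.prems unfolding residually_finite_def by auto
    show ?case
      using finite_quotient_Int[OF N(1) M(1) N(2) M(2)] N(3) M(3) by (intro exI[of _ "N \<inter> M"]) auto
  qed
  then show ?thesis using that by blast
qed

context weighted_group
begin

lemma finite_quotient_Mod:
  assumes "N \<lhd> G" "finite (carrier (G Mod N))"
  shows "finite_quotient G \<omega> (G Mod N) (\<lambda>t. N #> t)"
proof -
  interpret N: normal N G by fact
  interpret Q: group "G Mod N" by (rule N.factorgroup_is_group)
  show ?thesis
    by unfold_locales
      (use assms N.r_coset_hom_Mod in \<open>auto simp: FactGroup_def RCOSETS_def\<close>)
qed

text \<open>
  Outside a large finite set the mass of \<open>f\<close> is at most half of the norm of \<open>f t0\<close>, so if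
  \<open>f t0\<close> is not zero, no sum over a set of points that contains \<open>t0\<close> and avoids the rest of the finite set
  can vanish.
\<close>
lemma infsum_nonzero_if_dominant:
  assumes f: "f \<in> carrier A" and t0: "t0 \<in> carrier G"
  obtains F where "finite F" "F \<subseteq> carrier G - {t0}"
    "\<And>P. P t0 \<Longrightarrow> (\<And>s. s \<in> F \<Longrightarrow> \<not> P s) \<Longrightarrow> f t0 \<noteq> 0 \<Longrightarrow>
      (\<Sum>\<^sub>\<infinity>s\<in>carrier G. f s * (if P s then 1 else 0)) \<noteq> 0"
proof (cases "f t0 = 0")
  case True
  then show ?thesis using that[of "{}"] by auto
next
  case False
  define e where "e = norm (f t0) / 2"
  have e: "e > 0" using False by (simp add: e_def)
  have sn: "(\<lambda>s. norm (f s)) summable_on carrier G"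
    using summable_bounded[OF f, of "\<lambda>_. 1" 1] by simp
  obtain F where F: "finite F" "F \<subseteq> carrier G"
    "dist (sum (\<lambda>s. norm (f s)) F) (\<Sum>\<^sub>\<infinity>s\<in>carrier G. norm (f s)) \<le> e"
    using infsum_finite_approximation[OF sn e] by blast
  let ?F = "insert t0 F" and ?R = "carrier G - insert t0 F"
  have snR: "(\<lambda>s. norm (f s)) summable_on ?R"
    by (rule summable_on_subset_banach[OF sn]) auto
  have un: "?F \<union> ?R = carrier G" using F t0 by auto
  have "(\<Sum>\<^sub>\<infinity>s\<in>carrier G. norm (f s)) = (\<Sum>\<^sub>\<infinity>s\<in>?F. norm (f s)) + (\<Sum>\<^sub>\<infinity>s\<in>?R. norm (f s))"
    using infsum_Un_disjoint[of "\<lambda>s. norm (f s)" ?F ?R] F(1) snR un by simp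
  moreover have "(\<Sum>\<^sub>\<infinity>s\<in>?F. norm (f s)) \<ge> sum (\<lambda>s. norm (f s)) F"
    using F(1) by (simp only: infsum_finite finite_insert) (intro sum_mono2, auto)
  ultimately have tail: "(\<Sum>\<^sub>\<infinity>s\<in>?R. norm (f s)) \<le> e" using F(3) by (simp add: dist_real_def)
  show ?thesis
  proof (rule that[of "F - {t0}"])
    fix P assume P: "P t0" "\<And>s. s \<in> F - {t0} \<Longrightarrow> \<not> P s" and "f t0 \<noteq> 0"
    let ?g = "\<lambda>s. f s * (if P s then 1 else 0)"
    have ab: "?g abs_summable_on carrier G" by (rule summable_bounded[OF f, of _ 1]) simp
    have abR: "?g abs_summable_on ?R" by (rule summable_on_subset_banach[OF ab]) auto
    have "infsum ?g (carrier G) = infsum ?g ?F + infsum ?g ?R"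
      using infsum_Un_disjoint[of ?g ?F ?R] F(1) abs_summable_summable[OF abR] un by simp
    moreover have "infsum ?g ?F = f t0"
    proof -
      have "infsum ?g ?F = (\<Sum>s\<in>?F. ?g s)" using F(1) by (simp only: infsum_finite finite_insert)
      also have "\<dots> = ?g t0 + (\<Sum>s\<in>F - {t0}. ?g s)" using F(1) by (rule sum.insert_remove)
      also have "(\<Sum>s\<in>F - {t0}. ?g s) = 0" using P(2) by (intro sum.neutral) auto
      finally show ?thesis using P(1) by simp
    qed
    moreover have "norm (infsum ?g ?R) \<le> e"
    proof -
      have "norm (infsum ?g ?R) \<le> (\<Sum>\<^sub>\<infinity>s\<in>?R. norm (?g s))" by (rule norm_infsum_bound[OF abR])
      also have "\<dots> \<le> (\<Sum>\<^sub>\<infinity>s\<in>?R. norm (f s))" by (rule infsum_mono[OF abR snR]) simp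
      finally show ?thesis using tail by simp
    qed
    ultimately show "infsum ?g (carrier G) \<noteq> 0"
      using False by (auto simp: e_def add_eq_0_iff)
  qed (use F in auto)
qed

text \<open>
  Residual finiteness provides a finite quotient in which \<open>t0\<close> is separated from the finitely many points
  at which \<open>f\<close> might be large; the sum of \<open>f\<close> over the coset of \<open>t0\<close> is then not zero.
\<close>
theorem Inter_finite_codim_maximal_left_ideals:
  assumes "residually_finite G"
  shows "\<Inter> {I. maximal_left_ideal A I \<and> finite_codim A I} = {\<zero>\<^bsub>A\<^esub>}"
proof -
  have sep: "\<exists>M. maximal_left_ideal A M \<and> finite_codim A M \<and> f \<notin> M"
    if f: "f \<in> carrier A" "f \<noteq> 0" for f
  proof -
    obtain t0 where t0: "f t0 \<noteq> 0" using f(2) by (auto simp: fun_eq_iff)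
    then have t0G: "t0 \<in> carrier G" using zero_off[OF f(1)] by blast
    obtain F where F: "finite F" "F \<subseteq> carrier G - {t0}"
      and dom: "\<And>P. P t0 \<Longrightarrow> (\<And>s. s \<in> F \<Longrightarrow> \<not> P s) \<Longrightarrow> f t0 \<noteq> 0 \<Longrightarrow>
        (\<Sum>\<^sub>\<infinity>s\<in>carrier G. f s * (if P s then 1 else 0)) \<noteq> 0"
      using infsum_nonzero_if_dominant[OF f(1) t0G] by metis
    have "(\<lambda>s. s \<otimes> inv t0) ` F \<subseteq> carrier G - {\<one>}"
    proof
      fix g assume "g \<in> (\<lambda>s. s \<otimes> inv t0) ` F"
      then obtain s where s: "s \<in> F" "g = s \<otimes> inv t0" by auto
      then have "s \<in> carrier G" "s \<noteq> t0" using F by auto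
      then show "g \<in> carrier G - {\<one>}" using t0G s inv_equality[of s "inv t0"] by auto
    qed
    then obtain N where N: "N \<lhd> G" "finite (carrier (G Mod N))" "N \<inter> (\<lambda>s. s \<otimes> inv t0) ` F = {}"
      using residually_finite_avoid_finite[OF assms] F(1) by (metis finite_imageI)
    interpret N: normal N G by fact
    interpret fq: finite_quotient G \<omega> "G Mod N" "\<lambda>t. N #> t"
      by (rule finite_quotient_Mod[OF N(1,2)])
    have "N #> s \<noteq> N #> t0" if "s \<in> F" for s
    proof
      assume eq: "N #> s = N #> t0"
      have sG: "s \<in> carrier G" using that F by auto
      have "s \<in> N #> t0" using rcos_self[OF sG N.is_subgroup] eq by simp
      then have "s \<otimes> inv t0 \<in> N" by (rule N.rcos_module_imp[OF is_group t0G])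
      then show False using N(3) that by auto
    qed
    then have "fq.fibre f (N #> t0) \<noteq> 0"
      unfolding fq.fibre_def by (intro dom t0) auto
    from fq.separating_maximal_left_ideal[OF f(1) fq.p_closed[OF t0G] this]
    show ?thesis by metis
  qed
  have "delta \<one> \<one> = 1" by (simp add: delta_def)
  then have "delta \<one> \<noteq> 0" by auto
  then obtain M where M: "maximal_left_ideal A M" "finite_codim A M" using sep delta_closed one_closed by metis
  have I: "I \<subseteq> carrier A" "0 \<in> I" if "maximal_left_ideal A I" for I
    using that fn.subspace_0 unfolding maximal_left_ideal_def left_ideal_iff by auto
  show ?thesis unfolding module_ops_A
  proof (intro equalityI subsetI)
    fix f assume f: "f \<in> \<Inter> {I. maximal_left_ideal A I \<and> finite_codim A I}"
    then have "f \<in> carrier A" using M I(1)[OF M(1)] by auto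
    then show "f \<in> {0}" using sep[of f] f by auto
  qed (use I(2) in auto)
qed

end

section \<open>The group acting on a finite-dimensional quotient\<close>

abbreviation complex_field :: "complex ring" where
  "complex_field \<equiv> ring_of_type_algebra"

lemma complex_field_simps:
  "carrier complex_field = UNIV" "\<one>\<^bsub>complex_field\<^esub> = 1" "\<zero>\<^bsub>complex_field\<^esub> = 0"
  "x \<otimes>\<^bsub>complex_field\<^esub> y = x * y" "x \<oplus>\<^bsub>complex_field\<^esub> y = x + y"
  by (simp_all add: ring_of_type_algebra_def)

lemma finsum_complex_field:
  "finite B \<Longrightarrow> finsum complex_field F B = sum F B"
proof (induction B rule: finite_induct)
  interpret field complex_field by (rule field_from_type_algebra)
  case empty show ?case by (simp add: complex_field_simps)
next
  interpret field complex_field by (rule field_from_type_algebra)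
  case (insert x B)
  then show ?case by (subst finsum_insert) (auto simp: complex_field_simps)
qed

context weighted_group
begin

lemma shift_one: "f \<in> carrier A \<Longrightarrow> shift \<one> f = f"
  by (auto simp: shift_def fun_eq_iff zero_off)

lemma shift_shift: "g \<in> carrier G \<Longrightarrow> h \<in> carrier G \<Longrightarrow> shift g (shift h f) = shift (g \<otimes> h) f"
  by (auto simp: shift_def fun_eq_iff inv_mult_group m_assoc)

lemma shift_delta:
  assumes "g \<in> carrier G" "h \<in> carrier G"
  shows "shift g (delta h) = delta (g \<otimes> h)"
proof -
  have "inv g \<otimes> t = h \<longleftrightarrow> t = g \<otimes> h" if "t \<in> carrier G" for t
    using inv_solve_left[of h g t] that assms by metis
  then show ?thesis using assms by (auto simp: shift_def delta_def fun_eq_iff)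
qed

lemma shift_add: "shift g (e + f) = shift g e + shift g f"
  and shift_diff: "shift g (e - f) = shift g e - shift g f"
  and shift_scale: "shift g (\<lambda>t. c * f t) = (\<lambda>t. c * shift g f t)"
  by (auto simp: shift_def fun_eq_iff)

lemma shift_sum: "shift g (\<Sum>x\<in>K. F x) = (\<Sum>x\<in>K. shift g (F x))"
  by (auto simp: shift_def fun_eq_iff sum_fun_apply)

lemma finite_codimE:
  assumes "finite_codim A I" "fn.subspace I"
  obtains B where "finite B" "B \<subseteq> carrier A" "carrier A \<subseteq> fn.span (I \<union> B)"
proof -
  obtain B where B: "finite B" "B \<subseteq> carrier A"
    and *: "\<forall>x\<in>carrier A. \<exists>c. \<exists>y\<in>I. x = y \<oplus>\<^bsub>A\<^esub> (\<Oplus>\<^bsub>A\<^esub>b\<in>B. c b \<odot>\<^bsub>A\<^esub> b)"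
    using assms(1) unfolding finite_codim_def by blast
  have "x \<in> fn.span (I \<union> B)" if x: "x \<in> carrier A" for x
  proof -
    obtain c y where "y \<in> I" and "x = y \<oplus>\<^bsub>A\<^esub> (\<Oplus>\<^bsub>A\<^esub>b\<in>B. c b \<odot>\<^bsub>A\<^esub> b)" using * x by blast
    moreover have "(\<Oplus>\<^bsub>A\<^esub>b\<in>B. c b \<odot>\<^bsub>A\<^esub> b) = (\<Sum>b\<in>B. (\<lambda>t. c b * b t))"
      using B fn.subspace_scale[OF subspace_carrier]
      by (subst finsum_A) (auto simp: module_ops_A)
    ultimately have "x = y + (\<Sum>b\<in>B. (\<lambda>t. c b * b t))" "y \<in> I" by (simp_all only: module_ops_A)
    then show ?thesis
      by (auto intro!: fn.span_add fn.span_sum fn.span_scale simp: fn.span_base)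
  qed
  then show ?thesis using B that by blast
qed

text \<open>
  In the coordinates of a basis modulo \<open>I\<close>, translation by \<open>g\<close> becomes a complex matrix \<open>h g\<close>, and \<open>h\<close> is
  a homomorphism into a general linear group. If its kernel were trivial, \<open>G\<close> would be linear.
\<close>
lemma trivially_acting_normal_subgroup:
  assumes I: "left_ideal A I" "finite_codim A I"
    and G: "countable (carrier G)" "\<not> linear_group G"
  obtains N where "N \<lhd> G" "N \<noteq> {\<one>}"
    "\<And>m a. m \<in> N \<Longrightarrow> a \<in> carrier A \<Longrightarrow> shift m a - a \<in> I"
proof -
  have Is: "fn.subspace I" and IA: "I \<subseteq> carrier A"
    and Im: "\<And>a x. a \<in> carrier A \<Longrightarrow> x \<in> I \<Longrightarrow> a \<otimes>\<^bsub>A\<^esub> x \<in> I"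
    using I(1) unfolding left_ideal_iff by auto
  have Ish: "shift g x \<in> I" if "g \<in> carrier G" "x \<in> I" for g x
    using Im[OF delta_closed[OF that(1)] that(2)] that(1) by (simp add: delta_mult)
  obtain B0 where B0: "finite B0" "B0 \<subseteq> carrier A" "carrier A \<subseteq> fn.span (I \<union> B0)"
    using finite_codimE[OF I(2) Is] by blast
  obtain B \<phi> where B: "finite B" "B \<subseteq> B0"
    and \<phi>_add': "\<And>b x y. x \<in> fn.span (I \<union> B0) \<Longrightarrow> y \<in> fn.span (I \<union> B0) \<Longrightarrow> \<phi> b (x + y) = \<phi> b x + \<phi> b y"
    and \<phi>_scale': "\<And>b c x. x \<in> fn.span (I \<union> B0) \<Longrightarrow> \<phi> b (\<lambda>t. c * x t) = c * \<phi> b x"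
    and \<phi>_I: "\<And>b x. b \<in> B \<Longrightarrow> x \<in> I \<Longrightarrow> \<phi> b x = 0"
    and \<phi>_B: "\<And>b b'. b \<in> B \<Longrightarrow> b' \<in> B \<Longrightarrow> \<phi> b b' = (if b = b' then 1 else 0)"
    and \<phi>_rep': "\<And>x. x \<in> fn.span (I \<union> B0) \<Longrightarrow> x - (\<Sum>b\<in>B. (\<lambda>t. \<phi> b x * b t)) \<in> I"
    by (rule fn.coordinates_mod_subspace[OF Is B0(1)], rule that)
  have BA: "B \<subseteq> carrier A" using B B0 by auto
  have \<phi>_add: "\<phi> b (x + y) = \<phi> b x + \<phi> b y" if "x \<in> carrier A" "y \<in> carrier A" for b x y
    using that B0(3) by (intro \<phi>_add') auto
  have \<phi>_scale: "\<phi> b (\<lambda>t. c * x t) = c * \<phi> b x" if "x \<in> carrier A" for b c x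
    using that B0(3) by (intro \<phi>_scale') auto
  have \<phi>_rep: "x - (\<Sum>b\<in>B. (\<lambda>t. \<phi> b x * b t)) \<in> I" if "x \<in> carrier A" for x
    using that B0(3) by (intro \<phi>_rep') auto
  have \<phi>_sum: "\<phi> b (\<Sum>k\<in>B. (\<lambda>t. c k * F k t)) = (\<Sum>k\<in>B. c k * \<phi> b (F k))"
    if "b \<in> B" "\<And>k. k \<in> B \<Longrightarrow> F k \<in> carrier A" for b c F
  proof -
    have "\<phi> b (\<Sum>k\<in>D. (\<lambda>t. c k * F k t)) = (\<Sum>k\<in>D. c k * \<phi> b (F k))" if "finite D" "D \<subseteq> B" for D
      using that
    proof (induction D rule: finite_induct)
      case empty
      show ?case unfolding sum.empty by (rule \<phi>_I[OF \<open>b \<in> B\<close> fn.subspace_0[OF Is]])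
    next
      case (insert k D)
      have 1: "(\<lambda>t. c k * F k t) \<in> carrier A"
        using insert.prems \<open>\<And>k. k \<in> B \<Longrightarrow> F k \<in> carrier A\<close>
        by (intro fn.subspace_scale[OF subspace_carrier]) auto
      have 2: "(\<Sum>k\<in>D. (\<lambda>t. c k * F k t)) \<in> carrier A"
        using insert.prems \<open>\<And>k. k \<in> B \<Longrightarrow> F k \<in> carrier A\<close>
        by (intro fn.subspace_sum[OF subspace_carrier] fn.subspace_scale[OF subspace_carrier]) auto
      have 3: "\<phi> b (\<lambda>t. c k * F k t) = c k * \<phi> b (F k)"
        using insert.prems \<open>\<And>k. k \<in> B \<Longrightarrow> F k \<in> carrier A\<close> by (intro \<phi>_scale) auto
      show ?case
        unfolding sum.insert[OF insert.hyps] \<phi>_add[OF 1 2] 3 using insert by simp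
    qed
    then show ?thesis using B(1) by blast
  qed

  define n where "n = card B"
  obtain \<beta> where \<beta>: "bij_betw \<beta> {..<n} B"
    using B(1) ex_bij_betw_nat_finite[of B] by (auto simp: n_def lessThan_atLeast0)
  have \<beta>B: "\<beta> i \<in> B" if "i < n" for i using \<beta> that by (auto simp: bij_betw_def)
  have \<beta>A: "\<beta> i \<in> carrier A" if "i < n" for i using \<beta>B[OF that] BA by auto
  have \<beta>_eq: "\<beta> i = \<beta> j \<longleftrightarrow> i = j" if "i < n" "j < n" for i j
    using \<beta> that by (auto simp: bij_betw_def inj_on_eq_iff)
  let ?M = "mat_monoid n complex_field"
  define h where "h g = (\<lambda>(i, j) \<in> {..<n} \<times> {..<n}. \<phi> (\<beta> i) (shift g (\<beta> j)))" for g
  have h_closed: "h g \<in> carrier ?M" for g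
    by (auto simp: h_def mat_monoid_def complex_field_simps)
  have h_one: "h \<one> = \<one>\<^bsub>?M\<^esub>"
    unfolding h_def mat_monoid_def monoid.simps
    by (intro restrict_ext) (auto simp: shift_one \<beta>A \<phi>_B \<beta>B \<beta>_eq complex_field_simps)
  \<comment> \<open>Expand the translate of \<open>\<beta> j\<close> by \<open>g'\<close> modulo \<open>I\<close> in the basis; translation by \<open>g\<close> preserves \<open>I\<close>.\<close>
  have entry: "\<phi> (\<beta> i) (shift (g \<otimes> g') (\<beta> j))
      = (\<Sum>k<n. \<phi> (\<beta> i) (shift g (\<beta> k)) * \<phi> (\<beta> k) (shift g' (\<beta> j)))"
    if g: "g \<in> carrier G" "g' \<in> carrier G" and ij: "i < n" "j < n" for g g' i j
  proof -
    define z where "z = shift g' (\<beta> j)"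
    have z: "z \<in> carrier A" unfolding z_def by (rule shift_closed(1)[OF g(2) \<beta>A[OF ij(2)]])
    define y where "y = z - (\<Sum>b\<in>B. (\<lambda>t. \<phi> b z * b t))"
    have y: "y \<in> I" unfolding y_def by (rule \<phi>_rep[OF z])
    have "z = y + (\<Sum>b\<in>B. (\<lambda>t. \<phi> b z * b t))" unfolding y_def by (simp only: diff_add_cancel)
    then have "shift g z = shift g (y + (\<Sum>b\<in>B. (\<lambda>t. \<phi> b z * b t)))" by (rule arg_cong)
    then have "shift g z = shift g y + (\<Sum>b\<in>B. (\<lambda>t. \<phi> b z * shift g b t))"
      by (simp only: shift_add shift_sum shift_scale)
    moreover have "(\<Sum>b\<in>B. (\<lambda>t. \<phi> b z * shift g b t)) \<in> carrier A"
      using BA shift_closed(1)[OF g(1)]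
      by (intro fn.subspace_sum[OF subspace_carrier] fn.subspace_scale[OF subspace_carrier]) auto
    moreover have "shift g y \<in> I" by (rule Ish[OF g(1) y])
    ultimately have "\<phi> (\<beta> i) (shift g z) = (\<Sum>b\<in>B. \<phi> b z * \<phi> (\<beta> i) (shift g b))"
      using \<phi>_add[of "shift g y" "\<Sum>b\<in>B. (\<lambda>t. \<phi> b z * shift g b t)" "\<beta> i"] IA
        \<phi>_I[OF \<beta>B[OF ij(1)], of "shift g y"]
        \<phi>_sum[OF \<beta>B[OF ij(1)] shift_closed(1)[OF g(1) subsetD[OF BA]], of "\<lambda>b. b" "\<lambda>b. \<phi> b z"]
      by auto
    also have "\<dots> = (\<Sum>k<n. \<phi> (\<beta> k) z * \<phi> (\<beta> i) (shift g (\<beta> k)))"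
      by (rule sum.reindex_bij_betw[OF \<beta>, symmetric])
    finally show ?thesis using g by (simp add: z_def shift_shift mult.commute)
  qed
  have h_mult: "h (g \<otimes> g') = h g \<otimes>\<^bsub>?M\<^esub> h g'" if "g \<in> carrier G" "g' \<in> carrier G" for g g'
    unfolding mat_monoid_def monoid.simps
    unfolding h_def
    by (intro restrict_ext) (auto simp: entry that finsum_complex_field complex_field_simps)
  have field: "field complex_field" by (rule field_from_type_algebra)
  then have ring: "ring complex_field" by (rule field.is_ring)
  have "h g \<in> Units ?M" if "g \<in> carrier G" for g
    unfolding Units_def using h_closed that
    by (auto simp flip: h_mult h_one intro!: bexI[of _ "h (inv g)"])
  then have hom: "h \<in> hom G (GL n complex_field)"
    using h_mult by (auto simp: hom_def GL_def units_of_def)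
  interpret gh: group_hom G "GL n complex_field" h
    using hom GL_group[OF ring] by (simp add: group_hom_def group_hom_axioms_def is_group)
  define N where "N = kernel G (GL n complex_field) h"
  show ?thesis
  proof (rule that[of N])
    show "N \<lhd> G" unfolding N_def by (rule gh.normal_kernel)
    show "N \<noteq> {\<one>}"
    proof
      assume "N = {\<one>}"
      then have "inj_on h (carrier G)" using gh.inj_iff_trivial_ker by (simp add: N_def)
      then have "linear_over TYPE(complex) G" by (rule linear_overI[OF is_group field hom])
      then show False using linear_over_imp_linear_group[OF is_group G(1)] G(2) by blast
    qed
    fix m a assume m: "m \<in> N" and a: "a \<in> carrier A"
    have mG: "m \<in> carrier G" and hm: "h m = \<one>\<^bsub>?M\<^esub>"
      using m by (auto simp: N_def kernel_def GL_def units_of_def)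
    have base: "shift m b - b \<in> I" if b: "b \<in> B" for b
    proof -
      obtain j where j: "j < n" "b = \<beta> j" using \<beta> b by (auto simp: bij_betw_def)
      have "\<phi> b' (shift m b) = (if b' = b then 1 else 0)" if b': "b' \<in> B" for b'
      proof -
        obtain i where i: "i < n" "b' = \<beta> i" using \<beta> b' by (auto simp: bij_betw_def)
        show ?thesis using fun_cong[OF hm, of "(i, j)"] i j
          by (simp add: h_def mat_monoid_def complex_field_simps \<beta>_eq)
      qed
      then have "(\<Sum>b'\<in>B. (\<lambda>t. \<phi> b' (shift m b) * b' t)) = (\<Sum>b'\<in>B. if b' = b then b' else 0)"
        by (intro sum.cong) (auto simp: fun_eq_iff)
      also have "\<dots> = b" using B(1) b by simp
      finally have "(\<Sum>b'\<in>B. (\<lambda>t. \<phi> b' (shift m b) * b' t)) = b" .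
      moreover have "shift m b - (\<Sum>b'\<in>B. (\<lambda>t. \<phi> b' (shift m b) * b' t)) \<in> I"
        by (rule \<phi>_rep[OF shift_closed(1)[OF mG subsetD[OF BA b]]])
      ultimately show ?thesis by (simp only:)
    qed
    define y where "y = a - (\<Sum>b\<in>B. (\<lambda>t. \<phi> b a * b t))"
    have y: "y \<in> I" unfolding y_def by (rule \<phi>_rep[OF a])
    have a_eq: "a = y + (\<Sum>b\<in>B. (\<lambda>t. \<phi> b a * b t))" unfolding y_def by (simp only: diff_add_cancel)
    have "shift m a - a = (shift m y - y) + (\<Sum>b\<in>B. (\<lambda>t. \<phi> b a * (shift m b - b) t))"
      by (subst (1 2) a_eq)
        (auto simp: fun_eq_iff shift_def sum_fun_apply algebra_simps sum_subtractf)
    also have "\<dots> \<in> I"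
      by (intro fn.subspace_add[OF Is fn.subspace_diff[OF Is Ish[OF mG y] y]]
          fn.subspace_sum[OF Is] fn.subspace_scale[OF Is] base)
    finally show "shift m a - a \<in> I" .
  qed
qed

end

section \<open>Generators along a retraction onto coset representatives\<close>

context weighted_group
begin

lemma norm_le_wnorm:
  assumes "f \<in> carrier A" "t \<in> carrier G"
  shows "norm (f t) \<le> wnorm f"
proof -
  have "norm (f t) \<le> norm (f t) * \<omega> t"
    using weight_ge_1[OF assms(2)] by (simp add: mult_le_cancel_left1)
  also have "\<dots> = (\<Sum>s\<in>{t}. norm (f s) * \<omega> s)" by simp
  also have "\<dots> \<le> wnorm f" unfolding wnorm_def
  proof (rule finite_sum_le_infsum[OF summable_weighted[OF assms(1)]])
    show "0 \<le> norm (f s) * \<omega> s" if "s \<in> carrier G - {t}" for s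
      using weight_ge_1[of s] that by simp
  qed (use assms in auto)
  finally show ?thesis .
qed

lemma wnorm_add:
  assumes "f \<in> carrier A" "g \<in> carrier A"
  shows "wnorm (f + g) \<le> wnorm f + wnorm g"
proof -
  have "wnorm (f + g) \<le> (\<Sum>\<^sub>\<infinity>t\<in>carrier G. norm (f t) * \<omega> t + norm (g t) * \<omega> t)"
    unfolding wnorm_def
  proof (rule infsum_mono)
    show "(\<lambda>t. norm ((f + g) t) * \<omega> t) summable_on carrier G"
      using summable_weighted[OF fn.subspace_add[OF subspace_carrier assms]] .
    show "(\<lambda>t. norm (f t) * \<omega> t + norm (g t) * \<omega> t) summable_on carrier G"
      using assms by (intro summable_on_add summable_weighted)
    fix t assume t: "t \<in> carrier G"
    show "norm ((f + g) t) * \<omega> t \<le> norm (f t) * \<omega> t + norm (g t) * \<omega> t"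
      using mult_right_mono[OF norm_triangle_ineq[of "f t" "g t"], of "\<omega> t"] weight_ge_1[OF t]
      by (simp add: distrib_right)
  qed
  also have "\<dots> = wnorm f + wnorm g"
    unfolding wnorm_def using assms by (intro infsum_add summable_weighted)
  finally show ?thesis .
qed

lemma wnorm_zero: "wnorm 0 = 0"
  by (simp add: wnorm_def)

lemma wnorm_delta_one: "wnorm (delta \<one>) = 1"
proof -
  have "wnorm (delta \<one>) = (\<Sum>\<^sub>\<infinity>t\<in>{\<one>}. norm (delta \<one> t) * \<omega> t)"
    unfolding wnorm_def by (rule infsum_cong_neutral) (auto simp: delta_def)
  then show ?thesis using weight by (simp add: delta_def group_weight_def)
qed

abbreviation word_value :: "'a list \<Rightarrow> 'a" where
  "word_value w \<equiv> foldr (\<otimes>) w \<one>"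

text \<open>
  The differences that generate: \<open>x\<close> ranges over the generators of the group and \<open>u\<close> over the coset
  representatives.
\<close>
definition retract_gen :: "('a \<Rightarrow> 'a) \<Rightarrow> 'a \<times> 'a \<Rightarrow> 'a \<Rightarrow> complex" where
  "retract_gen r = (\<lambda>(x, u) t. delta (x \<otimes> u) t - delta (r (x \<otimes> u)) t)"

text \<open>
  The value at a point of \<open>G\<close> of the convolution of \<open>a\<close> with \<open>retract_gen r (x, u)\<close>. As a pointwise
  formula it makes sense for every function \<open>a\<close> and is visibly linear in \<open>a\<close>.
\<close>
definition mult_gen :: "('a \<Rightarrow> 'a) \<Rightarrow> ('a \<Rightarrow> complex) \<Rightarrow> 'a \<times> 'a \<Rightarrow> 'a \<Rightarrow> complex" where
  "mult_gen r a = (\<lambda>(x, u) t. a (t \<otimes> inv (x \<otimes> u)) - a (t \<otimes> inv (r (x \<otimes> u))))"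

text \<open>
  The left factor that the telescoping sum for the word attaches to the generator with index \<open>k\<close>. The
  recursion mirrors \<open>delta (x v) - delta (r (x v)) = delta x * (delta v - delta (r v)) +
  (delta (x (r v)) - delta (r (x (r v))))\<close>, which uses \<open>r (x (r v)) = r (x v)\<close>.
\<close>
fun word_coeff :: "('a \<Rightarrow> 'a) \<Rightarrow> 'a list \<Rightarrow> 'a \<times> 'a \<Rightarrow> 'a \<Rightarrow> complex" where
  "word_coeff r [] k = 0"
| "word_coeff r (x # w) k =
    shift x (word_coeff r w k) + (if k = (x, r (word_value w)) then delta \<one> else 0)"

lemma word_value_closed: "set w \<subseteq> carrier G \<Longrightarrow> word_value w \<in> carrier G"
  by (induction w) auto

lemma word_coeff_closed: "set w \<subseteq> carrier G \<Longrightarrow> word_coeff r w k \<in> carrier A"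
  by (induction w)
    (auto intro!: fn.subspace_add[OF subspace_carrier] fn.subspace_0[OF subspace_carrier]
      simp: shift_closed delta_closed simp del: plus_fun_apply)

text \<open>
  Translation by a letter at most doubles the norm and at most one point mass of norm \<open>1\<close> is added, so the bound obeys
  \<open>n \<mapsto> 2 n + 1\<close>, starting from \<open>0\<close>.
\<close>
lemma wnorm_word_coeff:
  assumes "set w \<subseteq> carrier G" "\<And>x. x \<in> set w \<Longrightarrow> \<omega> x \<le> 2"
  shows "wnorm (word_coeff r w k) \<le> 2 ^ length w - 1"
  using assms
proof (induction w)
  case Nil
  then show ?case by (simp only: word_coeff.simps wnorm_zero) simp
next
  case (Cons x w)
  let ?c = "word_coeff r w k" and ?d = "if k = (x, r (word_value w)) then delta \<one> else (0 :: 'a \<Rightarrow> complex)"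
  have x: "x \<in> carrier G" and c: "?c \<in> carrier A" using Cons.prems word_coeff_closed by auto
  have d: "?d \<in> carrier A" "wnorm ?d \<le> 1"
    using delta_closed[OF one_closed] fn.subspace_0[OF subspace_carrier] wnorm_zero wnorm_delta_one
    by (cases "k = (x, r (word_value w))"; simp only: if_True if_False; simp)+
  have "wnorm (shift x ?c + ?d) \<le> wnorm (shift x ?c) + wnorm ?d"
    by (rule wnorm_add[OF shift_closed(1)[OF x c] d(1)])
  also have "wnorm (shift x ?c) \<le> 2 * (2 ^ length w - 1)"
  proof -
    have "wnorm (shift x ?c) \<le> \<omega> x * wnorm ?c" by (rule shift_closed(2)[OF x c])
    also have "\<dots> \<le> 2 * (2 ^ length w - 1)"
      using Cons wnorm_nonneg weight_ge_1[OF x] by (intro mult_mono) auto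
    finally show ?thesis .
  qed
  finally have "wnorm (shift x ?c + ?d) \<le> 2 * (2 ^ length w - 1) + wnorm ?d" by simp
  moreover have "2 * (2 ^ n - 1) + y \<le> 2 ^ Suc n - (1 :: real)" if "y \<le> 1" for n y
    using that by simp
  from this[OF d(2)] have "2 * (2 ^ length w - 1) + wnorm ?d \<le> 2 ^ length (x # w) - 1"
    unfolding length_Cons .
  ultimately show ?case unfolding word_coeff.simps by (rule order_trans)
qed

lemma mult_retract_gen:
  assumes "a \<in> carrier A" "x \<in> carrier G" "u \<in> carrier G" "r (x \<otimes> u) \<in> carrier G"
  shows "a \<otimes>\<^bsub>A\<^esub> retract_gen r (x, u) = (\<lambda>t. if t \<in> carrier G then mult_gen r a (x, u) t else 0)"
  unfolding retract_gen_def prod.case using assms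
  by (subst mult_delta_diff) (auto simp: mult_delta mult_gen_def fun_eq_iff)

lemma word_telescope:
  assumes r: "\<And>t. t \<in> carrier G \<Longrightarrow> r t \<in> carrier G" "r \<one> = \<one>"
    "\<And>x t. x \<in> carrier G \<Longrightarrow> t \<in> carrier G \<Longrightarrow> r (x \<otimes> r t) = r (x \<otimes> t)"
    and fin: "finite S" "S \<subseteq> carrier G" "finite (r ` carrier G)"
    and w: "set w \<subseteq> S" and t: "t \<in> carrier G"
  shows "(\<Sum>k\<in>S \<times> r ` carrier G. mult_gen r (word_coeff r w k) k t)
    = delta (word_value w) t - delta (r (word_value w)) t"
  using w t
proof (induction w arbitrary: t)
  case Nil
  then show ?case by (simp add: mult_gen_def case_prod_unfold r(2))
next
  case (Cons x w)
  let ?K = "S \<times> r ` carrier G" and ?v = "word_value w"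
  have x: "x \<in> carrier G" "x \<in> S" and v: "?v \<in> carrier G"
    using Cons.prems fin(2) word_value_closed[of w] by auto
  have K: "finite ?K" using fin by simp
  have eq_inv: "t \<otimes> inv y = \<one> \<longleftrightarrow> t = y" if "y \<in> carrier G" for y
    using that Cons.prems(2) by (metis inv_closed inv_equality inv_inv r_inv)
  have step: "mult_gen r (word_coeff r (x # w) k) k t
      = mult_gen r (word_coeff r w k) k (inv x \<otimes> t)
        + (if k = (x, r ?v) then delta (x \<otimes> r ?v) t - delta (r (x \<otimes> ?v)) t else 0)"
    if "k \<in> ?K" for k
  proof -
    obtain y u where "k = (y, u)" by (cases k)
    then have k: "k = (y, u)" "y \<in> carrier G" "u \<in> carrier G" using that fin(2) r(1) by auto
    have "shift x a (t \<otimes> inv z) = a (inv x \<otimes> t \<otimes> inv z)" if "z \<in> carrier G" for a z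
      using that x Cons.prems(2) by (simp add: shift_def m_assoc)
    moreover have "delta \<one> (t \<otimes> inv z) = delta z t" if "z \<in> carrier G" for z
      using eq_inv[OF that] by (auto simp: delta_def)
    ultimately show ?thesis using k r(1,3) x v by (auto simp: mult_gen_def)
  qed
  have "(\<Sum>k\<in>?K. mult_gen r (word_coeff r (x # w) k) k t)
      = (\<Sum>k\<in>?K. mult_gen r (word_coeff r w k) k (inv x \<otimes> t))
        + (\<Sum>k\<in>?K. if k = (x, r ?v) then delta (x \<otimes> r ?v) t - delta (r (x \<otimes> ?v)) t else 0)"
    by (simp only: sum.cong[OF refl step] sum.distrib)
  also have "(\<Sum>k\<in>?K. if k = (x, r ?v) then delta (x \<otimes> r ?v) t - delta (r (x \<otimes> ?v)) t else 0)
      = delta (x \<otimes> r ?v) t - delta (r (x \<otimes> ?v)) t"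
    using K x v by (subst sum.delta) auto
  also have "(\<Sum>k\<in>?K. mult_gen r (word_coeff r w k) k (inv x \<otimes> t))
      = delta ?v (inv x \<otimes> t) - delta (r ?v) (inv x \<otimes> t)"
    using Cons.prems x by (intro Cons.IH) auto
  finally have eq: "(\<Sum>k\<in>?K. mult_gen r (word_coeff r (x # w) k) k t)
      = delta ?v (inv x \<otimes> t) - delta (r ?v) (inv x \<otimes> t)
        + (delta (x \<otimes> r ?v) t - delta (r (x \<otimes> ?v)) t)" .
  have "delta y (inv x \<otimes> t) = delta (x \<otimes> y) t" if "y \<in> carrier G" for y
    using inv_solve_left[of y x t] that x Cons.prems(2) by (auto simp: delta_def)
  then show ?case unfolding eq using v r(1) by simp
qed

text \<open>
  The left factors of a geodesic word for \<open>g\<close> have norm at most \<open>\<omega> g\<close>. Hence superposing them with the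
  coefficients \<open>f g\<close> stays inside the algebra, and superposing the telescoping identities leaves over only
  the mass of \<open>f\<close> pushed forward along \<open>r\<close>, which is supported on the finite image of \<open>r\<close>.
\<close>
theorem decomposition_along_retraction:
  assumes r: "\<And>t. t \<in> carrier G \<Longrightarrow> r t \<in> carrier G" "r \<one> = \<one>"
    "\<And>x t. x \<in> carrier G \<Longrightarrow> t \<in> carrier G \<Longrightarrow> r (x \<otimes> r t) = r (x \<otimes> t)"
    and fin: "finite S" "S \<subseteq> carrier G" "finite (r ` carrier G)"
    and S: "\<And>x. x \<in> S \<Longrightarrow> \<omega> x \<le> 2"
    and words: "\<And>g. g \<in> carrier G \<Longrightarrow> set (word g) \<subseteq> S \<and> word_value (word g) = g \<and> 2 ^ length (word g) \<le> \<omega> g"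
    and f: "f \<in> carrier A"
  shows "\<exists>b. (\<forall>k \<in> S \<times> r ` carrier G. b k \<in> carrier A) \<and>
    f - (\<Sum>k\<in>S \<times> r ` carrier G. b k \<otimes>\<^bsub>A\<^esub> retract_gen r k) \<in> fn.span (delta ` r ` carrier G)"
proof -
  let ?T = "r ` carrier G" let ?K = "S \<times> ?T"
  define b where "b k = (\<lambda>t. \<Sum>\<^sub>\<infinity>g\<in>carrier G. f g * word_coeff r (word g) k t)" for k
  have wG: "set (word g) \<subseteq> carrier G" if "g \<in> carrier G" for g using words[OF that] fin(2) by auto
  have bound: "wnorm (word_coeff r (word g) k) \<le> \<omega> g" if "g \<in> carrier G" for g k
    using wnorm_word_coeff[OF wG[OF that], of r k] words[OF that] S by force
  have sum_bound: "(\<lambda>g. norm (f g) * wnorm (word_coeff r (word g) k)) summable_on carrier G" for k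
  proof (rule summable_on_comparison_test[OF summable_weighted[OF f]])
    show "norm (f g) * wnorm (word_coeff r (word g) k) \<le> norm (f g) * \<omega> g" if "g \<in> carrier G" for g
      using bound[OF that] by (rule mult_left_mono) simp
    show "0 \<le> norm (f g) * wnorm (word_coeff r (word g) k)" for g
      by (intro mult_nonneg_nonneg norm_ge_zero wnorm_nonneg)
  qed
  have b: "b k \<in> carrier A" for k
    unfolding b_def by (rule superposition_closed[OF word_coeff_closed[OF wG] sum_bound])
  have sm: "(\<lambda>g. f g * word_coeff r (word g) k t) summable_on carrier G" if t: "t \<in> carrier G" for k t
  proof (rule abs_summable_summable, rule abs_summable_on_comparison_test'[OF sum_bound[of k]])
    fix g assume g: "g \<in> carrier G"
    show "norm (f g * word_coeff r (word g) k t) \<le> norm (f g) * wnorm (word_coeff r (word g) k)"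
      unfolding norm_mult
      by (rule mult_left_mono[OF norm_le_wnorm[OF word_coeff_closed[OF wG[OF g]] t]]) simp
  qed
  define c where "c u = (\<Sum>\<^sub>\<infinity>g\<in>carrier G. f g * (if r g = u then 1 else 0))" for u
  have main: "(f - (\<Sum>k\<in>?K. b k \<otimes>\<^bsub>A\<^esub> retract_gen r k)) t = c t" if t: "t \<in> carrier G" for t
  proof -
    have gen: "mult_gen r (b k) k t = (\<Sum>\<^sub>\<infinity>g\<in>carrier G. f g * mult_gen r (word_coeff r (word g) k) k t)"
      and gen_sm: "(\<lambda>g. f g * mult_gen r (word_coeff r (word g) k) k t) summable_on carrier G"
      if "k \<in> ?K" for k
    proof -
      obtain x u where "k = (x, u)" by (cases k)
      then have k: "k = (x, u)" "x \<in> carrier G" "u \<in> carrier G" using that fin(2) r(1) by auto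
      let ?s = "t \<otimes> inv (x \<otimes> u)" and ?s' = "t \<otimes> inv (r (x \<otimes> u))"
      have s: "?s \<in> carrier G" "?s' \<in> carrier G" using k t r(1) by auto
      have eq: "f g * mult_gen r (word_coeff r (word g) k) k t
          = f g * word_coeff r (word g) k ?s + - (f g * word_coeff r (word g) k ?s')" for g
        by (simp add: k mult_gen_def algebra_simps)
      note sm' = sm[OF s(2), of k, folded summable_on_uminus[of "\<lambda>g. f g * word_coeff r (word g) k ?s'"]]
      show "(\<lambda>g. f g * mult_gen r (word_coeff r (word g) k) k t) summable_on carrier G"
        unfolding eq by (rule summable_on_add[OF sm[OF s(1)] sm'])
      show "mult_gen r (b k) k t = (\<Sum>\<^sub>\<infinity>g\<in>carrier G. f g * mult_gen r (word_coeff r (word g) k) k t)"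
        unfolding eq infsum_add[OF sm[OF s(1)] sm'] infsum_uminus
        by (simp add: b_def k mult_gen_def)
    qed
    have "(\<Sum>k\<in>?K. b k \<otimes>\<^bsub>A\<^esub> retract_gen r k) t = (\<Sum>k\<in>?K. mult_gen r (b k) k t)"
      unfolding sum_fun_apply
    proof (rule sum.cong[OF refl])
      fix k assume "k \<in> ?K"
      moreover obtain x u where "k = (x, u)" by (cases k)
      ultimately have k: "k = (x, u)" "x \<in> carrier G" "u \<in> carrier G" using fin(2) r(1) by auto
      then show "(b k \<otimes>\<^bsub>A\<^esub> retract_gen r k) t = mult_gen r (b k) k t"
        using t mult_retract_gen[OF b, of x u r k] r(1) by simp
    qed
    also have "\<dots> = (\<Sum>k\<in>?K. \<Sum>\<^sub>\<infinity>g\<in>carrier G. f g * mult_gen r (word_coeff r (word g) k) k t)"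
      by (rule sum.cong[OF refl gen])
    also have "\<dots> = (\<Sum>\<^sub>\<infinity>g\<in>carrier G. \<Sum>k\<in>?K. f g * mult_gen r (word_coeff r (word g) k) k t)"
      using fin gen_sm by (intro summable_on_sum(2)[symmetric]) auto
    also have "\<dots> = (\<Sum>\<^sub>\<infinity>g\<in>carrier G. f g * delta g t + - (f g * (if r g = t then 1 else 0)))"
    proof (rule infsum_cong)
      fix g assume g: "g \<in> carrier G"
      have "(\<Sum>k\<in>?K. mult_gen r (word_coeff r (word g) k) k t) = delta g t - delta (r g) t"
        using word_telescope[OF r fin, of "word g" t] words[OF g] t by simp
      then have "(\<Sum>k\<in>?K. f g * mult_gen r (word_coeff r (word g) k) k t)
          = f g * (delta g t - delta (r g) t)"
        by (simp only: sum_distrib_left[symmetric])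
      also have "\<dots> = f g * delta g t + - (f g * (if r g = t then 1 else 0))"
        by (simp add: delta_def algebra_simps)
      finally show "(\<Sum>k\<in>?K. f g * mult_gen r (word_coeff r (word g) k) k t)
          = f g * delta g t + - (f g * (if r g = t then 1 else 0))" .
    qed
    also have "\<dots> = f t - c t"
    proof -
      have 1: "(\<lambda>g. f g * delta g t) summable_on carrier G"
        by (rule abs_summable_summable, rule summable_bounded[OF f, of _ 1]) (simp add: delta_def)
      have 2: "(\<lambda>g. f g * (if r g = t then 1 else 0)) summable_on carrier G"
        by (rule abs_summable_summable, rule summable_bounded[OF f, of _ 1]) simp
      have "(\<Sum>\<^sub>\<infinity>g\<in>carrier G. f g * delta g t) = f t"
        using t by (subst infsum_point[of _ t]) (auto simp: delta_def)
      then show ?thesis unfolding c_def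
        using infsum_add[OF 1 iffD2[OF summable_on_uminus 2]] by (simp only: infsum_uminus) simp
    qed
    finally show ?thesis by simp
  qed
  have off: "c t = 0" if "t \<notin> ?T" for t
    unfolding c_def using that by (intro infsum_0) auto
  have "f - (\<Sum>k\<in>?K. b k \<otimes>\<^bsub>A\<^esub> retract_gen r k) = (\<Sum>u\<in>?T. (\<lambda>t. c u * delta u t))"
  proof (rule ext)
    fix t
    have rhs: "(\<Sum>u\<in>?T. (\<lambda>t. c u * delta u t)) t = c t"
      unfolding sum_fun_apply using fin(3) off[of t]
      by (auto simp: delta_def if_distrib cong: if_cong)
    show "(f - (\<Sum>k\<in>?K. b k \<otimes>\<^bsub>A\<^esub> retract_gen r k)) t = (\<Sum>u\<in>?T. (\<lambda>t. c u * delta u t)) t"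
    proof (cases "t \<in> carrier G")
      case True
      then show ?thesis unfolding rhs by (rule main)
    next
      case False
      have "(b k \<otimes>\<^bsub>A\<^esub> retract_gen r k) t = 0" for k using False by (simp add: beurling_def)
      moreover have "t \<notin> ?T" using False r(1) by auto
      ultimately show ?thesis unfolding rhs using zero_off[OF f False] off by (simp add: sum_fun_apply)
    qed
  qed
  also have "\<dots> \<in> fn.span (delta ` ?T)"
    by (intro fn.span_sum fn.span_scale fn.span_base) auto
  finally show ?thesis using b by (intro exI[of _ b] conjI ballI)
qed

lemma finitely_generated_left_idealI:
  assumes I: "left_ideal A I" and K: "finite K" and a: "\<And>k. k \<in> K \<Longrightarrow> a k \<in> I"
    and gen: "\<And>f. f \<in> I \<Longrightarrow> \<exists>b. (\<forall>k\<in>K. b k \<in> carrier A) \<and> f = (\<Sum>k\<in>K. b k \<otimes>\<^bsub>A\<^esub> a k)"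
  shows "finitely_generated_left_ideal A I"
proof -
  have Is: "fn.subspace I" and IA: "I \<subseteq> carrier A"
    and Im: "\<And>a x. a \<in> carrier A \<Longrightarrow> x \<in> I \<Longrightarrow> a \<otimes>\<^bsub>A\<^esub> x \<in> I"
    using I unfolding left_ideal_iff by auto
  define n where "n = card K"
  obtain e where e: "bij_betw e {..<n} K"
    using K ex_bij_betw_nat_finite[of K] by (auto simp: n_def lessThan_atLeast0)
  have eK: "e i \<in> K" if "i < n" for i using e that by (auto simp: bij_betw_def)
  have fs: "(\<Oplus>\<^bsub>A\<^esub>i\<in>{..<n}. b i \<otimes>\<^bsub>A\<^esub> a (e i)) = (\<Sum>i<n. b i \<otimes>\<^bsub>A\<^esub> a (e i))"
    if "b \<in> {..<n} \<rightarrow> carrier A" for b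
    using that a eK IA by (intro finsum_A) (auto intro!: mult_closed)
  have "I = {\<Oplus>\<^bsub>A\<^esub>i\<in>{..<n}. b i \<otimes>\<^bsub>A\<^esub> a (e i) | b. b \<in> {..<n} \<rightarrow> carrier A}" (is "I = ?R")
  proof (intro equalityI subsetI)
    fix f assume "f \<in> I"
    then obtain b where b: "\<forall>k\<in>K. b k \<in> carrier A" "f = (\<Sum>k\<in>K. b k \<otimes>\<^bsub>A\<^esub> a k)" using gen by blast
    have b': "(\<lambda>i. b (e i)) \<in> {..<n} \<rightarrow> carrier A" using b(1) eK by auto
    have "f = (\<Sum>i<n. b (e i) \<otimes>\<^bsub>A\<^esub> a (e i))"
      unfolding b(2) by (rule sum.reindex_bij_betw[OF e, symmetric])
    then have "f = (\<Oplus>\<^bsub>A\<^esub>i\<in>{..<n}. b (e i) \<otimes>\<^bsub>A\<^esub> a (e i))" using fs[OF b'] by simp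
    then show "f \<in> ?R" using b' by (intro CollectI exI[of _ "\<lambda>i. b (e i)"] conjI)
  next
    fix f assume "f \<in> ?R"
    then obtain b where b: "b \<in> {..<n} \<rightarrow> carrier A" "f = (\<Oplus>\<^bsub>A\<^esub>i\<in>{..<n}. b i \<otimes>\<^bsub>A\<^esub> a (e i))" by blast
    have "(\<Sum>i<n. b i \<otimes>\<^bsub>A\<^esub> a (e i)) \<in> I"
      using b(1) eK a by (intro fn.subspace_sum[OF Is] Im) auto
    then show "f \<in> I" using b fs by simp
  qed
  then show ?thesis unfolding finitely_generated_left_ideal_def
    using I a eK by (intro conjI exI[of _ n] exI[of _ "\<lambda>i. a (e i)"]) auto
qed

end

section \<open>Finite generation of finite-codimension left ideals\<close>

text \<open>
  The representative of the subgroup itself is chosen to be the identity, because the telescoping sum for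
  the empty word has to be empty. The compatibility with left multiplication holds since \<open>r\<close> depends only
  on the coset.
\<close>
lemma (in group) coset_retraction:
  assumes "N \<lhd> G" "finite (carrier (G Mod N))"
  obtains r where "\<And>t. t \<in> carrier G \<Longrightarrow> r t \<in> carrier G" "r \<one> = \<one>"
    "\<And>x t. x \<in> carrier G \<Longrightarrow> t \<in> carrier G \<Longrightarrow> r (x \<otimes> r t) = r (x \<otimes> t)"
    "finite (r ` carrier G)"
    "\<And>t. t \<in> carrier G \<Longrightarrow> inv t \<otimes> r t \<in> N"
proof -
  interpret N: normal N G by fact
  define \<rho> where "\<rho> C = (if C = N then \<one> else (SOME u. u \<in> C))" for C
  define r where "r t = \<rho> (N #> t)" for t
  have mem: "r t \<in> N #> t" if t: "t \<in> carrier G" for t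
  proof (cases "N #> t = N")
    case True
    then show ?thesis by (simp add: r_def \<rho>_def N.one_closed)
  next
    case False
    then show ?thesis
      using someI[of "\<lambda>u. u \<in> N #> t" t] rcos_self[OF t N.is_subgroup] by (simp add: r_def \<rho>_def)
  qed
  have rG: "r t \<in> carrier G" if t: "t \<in> carrier G" for t
    using mem[OF t] r_coset_subset_G[OF N.subset t] by auto
  have coset: "N #> r t = N #> t" if t: "t \<in> carrier G" for t
    using repr_independence[OF mem[OF t] t N.is_subgroup] by simp
  show ?thesis
  proof (rule that[of r])
    show "r t \<in> carrier G" if "t \<in> carrier G" for t using rG that .
    show "r \<one> = \<one>" by (simp add: r_def \<rho>_def coset_mult_one[OF N.subset])
    show "r (x \<otimes> r t) = r (x \<otimes> t)" if "x \<in> carrier G" "t \<in> carrier G" for x t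
      using N.rcos_sum[of x "r t"] N.rcos_sum[of x t] that rG coset by (simp add: r_def[of "x \<otimes> t" for t])
    have "r ` carrier G \<subseteq> \<rho> ` carrier (G Mod N)"
      by (auto simp: r_def FactGroup_def RCOSETS_def)
    then show "finite (r ` carrier G)" using assms(2) by (meson finite_imageI finite_subset)
    show "inv t \<otimes> r t \<in> N" if t: "t \<in> carrier G" for t
    proof -
      obtain m where m: "m \<in> N" "r t = m \<otimes> t" using mem[OF t] by (auto simp: r_coset_def)
      then show ?thesis
        using N.inv_op_closed1[OF t m(1)] t N.subset by (auto simp: m_assoc subset_iff)
    qed
  qed
qed

text \<open>
  Both conditions on \<open>\<omega>\<close> hold for \<open>2\<close> to the power of the word length, with geodesic words. The first one
  bounds the left factors in the telescoping sums by a power of \<open>2\<close>, and the second one bounds that power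
  by the weight.
\<close>
theorem (in weighted_group) finite_codim_left_ideal_finitely_generated:
  assumes G: "just_infinite G" "\<not> linear_group G"
    and S: "finite S" "S \<subseteq> carrier G" "generate G S = carrier G"
    and small: "\<And>x. x \<in> S \<Longrightarrow> \<omega> x \<le> 2"
    and words: "\<And>g. g \<in> carrier G \<Longrightarrow>
      \<exists>w. set w \<subseteq> S \<and> word_value w = g \<and> 2 ^ length w \<le> \<omega> g"
    and I: "left_ideal A I" "finite_codim A I"
  shows "finitely_generated_left_ideal A I"
proof -
  have Is: "fn.subspace I" and IA: "I \<subseteq> carrier A"
    and Im: "\<And>a x. a \<in> carrier A \<Longrightarrow> x \<in> I \<Longrightarrow> a \<otimes>\<^bsub>A\<^esub> x \<in> I"
    using I unfolding left_ideal_iff by auto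
  have "countable (carrier G)"
    using countable_carrier_if_generate[OF countable_finite[OF S(1)] S(3)] .
  then obtain N where N: "N \<lhd> G" "N \<noteq> {\<one>}"
    and triv: "\<And>m a. m \<in> N \<Longrightarrow> a \<in> carrier A \<Longrightarrow> shift m a - a \<in> I"
    using trivially_acting_normal_subgroup[OF I _ G(2)] by metis
  interpret N: normal N G by fact
  have "finite (carrier (G Mod N))" using G(1) N unfolding just_infinite_def by blast
  then obtain r where r: "\<And>t. t \<in> carrier G \<Longrightarrow> r t \<in> carrier G" "r \<one> = \<one>"
    "\<And>x t. x \<in> carrier G \<Longrightarrow> t \<in> carrier G \<Longrightarrow> r (x \<otimes> r t) = r (x \<otimes> t)"
    "finite (r ` carrier G)" "\<And>t. t \<in> carrier G \<Longrightarrow> inv t \<otimes> r t \<in> N"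
    using coset_retraction[OF N(1)] by metis
  let ?T = "r ` carrier G" let ?K = "S \<times> ?T"
  have diff: "delta s - delta (r s) \<in> I" if s: "s \<in> carrier G" for s
  proof -
    let ?m = "inv s \<otimes> r s"
    have m: "?m \<in> carrier G" using s r(1) by simp
    \<comment> \<open>Multiplying this element of \<open>I\<close> by the point mass at \<open>s\<close> gives the difference of the point masses at \<open>r s\<close> and \<open>s\<close>.\<close>
    have "shift ?m (delta \<one>) - delta \<one> \<in> I" by (rule triv[OF r(5)[OF s] delta_closed[OF one_closed]])
    then have "delta s \<otimes>\<^bsub>A\<^esub> (shift ?m (delta \<one>) - delta \<one>) \<in> I" by (rule Im[OF delta_closed[OF s]])
    then have "delta (r s) - delta s \<in> I"
      using s r(1)[OF s] m by (simp add: delta_mult shift_diff shift_delta flip: m_assoc)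
    then show ?thesis using fn.subspace_neg[OF Is] by (metis minus_diff_eq)
  qed
  have gen: "retract_gen r k \<in> I" if k: "k \<in> ?K" for k
  proof -
    obtain x u where xu: "k = (x, u)" by (cases k)
    have "retract_gen r k = delta (x \<otimes> u) - delta (r (x \<otimes> u))"
      by (simp add: xu retract_gen_def fun_eq_iff)
    moreover have "x \<otimes> u \<in> carrier G" using k xu S(2) r(1) by auto
    ultimately show ?thesis using diff by simp
  qed
  have "\<forall>g\<in>carrier G. \<exists>w. set w \<subseteq> S \<and> word_value w = g \<and> 2 ^ length w \<le> \<omega> g" using words by blast
  from bchoice[OF this] obtain word where word:
    "\<And>g. g \<in> carrier G \<Longrightarrow> set (word g) \<subseteq> S \<and> word_value (word g) = g \<and> 2 ^ length (word g) \<le> \<omega> g"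
    by blast
  have "fn.subspace (I \<inter> fn.span (delta ` ?T))"
    using Is fn.subspace_span by (rule fn.subspace_inter)
  then obtain D where D: "finite D" "D \<subseteq> I \<inter> fn.span (delta ` ?T)"
      "fn.independent D" "I \<inter> fn.span (delta ` ?T) = fn.span D"
    by (rule fn.subspace_finite_basis[OF _ Int_lower2 finite_imageI[OF r(4)]])
  define a where "a = case_sum (retract_gen r) (\<lambda>d. d)"
  show ?thesis
  proof (rule finitely_generated_left_idealI[OF I(1), of "Sum_Type.Plus ?K D" a])
    show "finite (Sum_Type.Plus ?K D)" using S(1) r(4) D(1) by simp
    show "a k \<in> I" if "k \<in> Sum_Type.Plus ?K D" for k
      using that
    proof (rule PlusE)
      show "a k \<in> I" if "x \<in> ?K" "k = Inl x" for x
        unfolding that(2) a_def sum.case by (rule gen[OF that(1)])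
      show "a k \<in> I" if "y \<in> D" "k = Inr y" for y
        unfolding that(2) a_def sum.case using that(1) D(2) by blast
    qed
    fix f assume f: "f \<in> I"
    obtain b where dec: "(\<forall>k\<in>?K. b k \<in> carrier A) \<and>
        f - (\<Sum>k\<in>?K. b k \<otimes>\<^bsub>A\<^esub> retract_gen r k) \<in> fn.span (delta ` ?T)"
      using decomposition_along_retraction[OF r(1-3) S(1,2) r(4) small word subsetD[OF IA f]]
      by (rule exE)
    note b = bspec[OF conjunct1[OF dec]] and rest = conjunct2[OF dec]
    let ?s = "\<Sum>k\<in>?K. b k \<otimes>\<^bsub>A\<^esub> retract_gen r k"
    have "?s \<in> I" using b gen by (intro fn.subspace_sum[OF Is] Im)
    then have "f - ?s \<in> fn.span D" using D(4) rest fn.subspace_diff[OF Is f] by blast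
    then obtain c where c: "f - ?s = (\<Sum>d\<in>D. (\<lambda>t. c d * d t))"
      using fn.span_finite[OF D(1)] by auto
    define b' where "b' = case_sum b (\<lambda>d t. c d * delta \<one> t)"
    have b'A: "b' k \<in> carrier A" if "k \<in> Sum_Type.Plus ?K D" for k
      using that
    proof (rule PlusE)
      show "b' k \<in> carrier A" if "x \<in> ?K" "k = Inl x" for x
        unfolding that(2) b'_def sum.case by (rule b[OF that(1)])
      show "b' k \<in> carrier A" if "k = Inr y" for y
        unfolding that b'_def sum.case
        by (rule fn.subspace_scale[OF subspace_carrier delta_closed[OF one_closed]])
    qed
    have eq: "(\<Sum>k\<in>Sum_Type.Plus ?K D. b' k \<otimes>\<^bsub>A\<^esub> a k) = f"
    proof -
      have "(\<Sum>k\<in>Sum_Type.Plus ?K D. b' k \<otimes>\<^bsub>A\<^esub> a k)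
          = ?s + (\<Sum>d\<in>D. (\<lambda>t. c d * delta \<one> t) \<otimes>\<^bsub>A\<^esub> d)"
        using S(1) r(4) D(1) by (subst sum.Plus) (simp_all add: b'_def a_def o_def)
      also have "(\<Sum>d\<in>D. (\<lambda>t. c d * delta \<one> t) \<otimes>\<^bsub>A\<^esub> d) = (\<Sum>d\<in>D. (\<lambda>t. c d * d t))"
        using D(2) IA by (intro sum.cong refl scaled_one_mult) auto
      also have "\<dots> = f - ?s" using c by (rule sym)
      also have "?s + (f - ?s) = f" by (rule trans[OF add.commute diff_add_cancel])
      finally show ?thesis .
    qed
    show "\<exists>b. (\<forall>k\<in>Sum_Type.Plus ?K D. b k \<in> carrier A) \<and> f = (\<Sum>k\<in>Sum_Type.Plus ?K D. b k \<otimes>\<^bsub>A\<^esub> a k)"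
      by (intro exI[of _ b'] conjI ballI b'A eq[symmetric])
  qed
qed

theorem theorem1p4:
  fixes G :: "('a, 'b) monoid_scheme" and S :: "'a set" and \<omega> :: "'a \<Rightarrow> real"
  assumes "group G"
    and "just_infinite G"
    and "residually_finite G"
    and "\<not> linear_group G"
    and "finite_symmetric_generating_set G S"
    and "\<omega> = (\<lambda>t. 2 ^ word_length G S t)"
  shows "\<Inter> {I. maximal_left_ideal (beurling G \<omega>) I \<and> finite_codim (beurling G \<omega>) I}
           = {\<zero>\<^bsub>beurling G \<omega>\<^esub>} \<and>
         (\<forall>I. left_ideal (beurling G \<omega>) I \<and> finite_codim (beurling G \<omega>) I
           \<longrightarrow> finitely_generated_left_ideal (beurling G \<omega>) I)"
proof -
  interpret group G by fact
  interpret weighted_group G \<omega>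
    using group_weight_power_word_length[OF assms(1,5)]
    by unfold_locales (simp add: assms(6))
  have S: "finite S" "S \<subseteq> carrier G" "generate G S = carrier G"
    using assms(5) by (auto simp: finite_symmetric_generating_set_def)
  have small: "\<omega> x \<le> 2" if "x \<in> S" for x
  proof -
    have "word_length G S x \<le> length [x]"
      using that S(2) by (intro word_length_le[OF assms(1,5)]) auto
    then have "(2::real) ^ word_length G S x \<le> 2 ^ 1" by (intro power_increasing) auto
    then show ?thesis by (simp add: assms(6))
  qed
  have words: "\<exists>w. set w \<subseteq> S \<and> foldr (\<otimes>\<^bsub>G\<^esub>) w \<one>\<^bsub>G\<^esub> = g \<and> 2 ^ length w \<le> \<omega> g" if "g \<in> carrier G" for g
    using word_length_witness[OF assms(1,5) that] by (metis assms(6) order_refl)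
  show ?thesis
    using Inter_finite_codim_maximal_left_ideals[OF assms(3)]
      finite_codim_left_ideal_finitely_generated[OF assms(2,4) S small words] by blast
qed

end
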